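(* Let $G$ be a simple graph on the vertex set $[n]=\{1,\dots,n\}$ with $e>0$ edges and vertex degrees $d_1,\dots,d_n$. Put $\alpha=0$ if $G$ is regular; otherwise put $\alpha=(2e-rn)/q$, where $q=\gcd(d_i-d_j:1\le i,j\le n)$ and $r$ is the least nonnegative residue of each $d_i$ modulo $q$. Then a signed $G$-decomposition of $\lambda K_n$ exists if and only if $\lambda_{\min}\mid\lambda$, where $$\lambda_{\min}=\ell(G):=\frac{2e}{\gcd\big(n(n-1),\,\alpha(n-1),\,2e\big)},$$ unless $G$ is isomorphic to the complete bipartite graph $K_{a,n-a}$ or to the disjoint union $K_a\,\dot\cup\,K_{n-a}$ of two cliques for some $a$ with $n\neq 2a$, in which case $$\lambda_{\min}=\operatorname{lcm}(2,\ell(G))=\frac{2e}{\gcd\big(n(n-1),\,a(n-1),\,a(n-a)\big)}.$$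
   Context: Identify a graph on $[n]$ with its adjacency matrix $G\in\mathbb{Z}^{n\times n}$. For a permutation $\sigma$ of $[n]$, $G^\sigma$ is the matrix with $(G^\sigma)_{ij}=G_{\sigma(i)\sigma(j)}$ (a permuted copy of $G$ on the same vertex set). For an integer $\lambda$, a signed $G$-decomposition of $\lambda K_n$ is a family of integers $(c_\sigma)_{\sigma\in S_n}$ with $\sum_{\sigma\in S_n}c_\sigma G^\sigma=\lambda(J-I)$, where $J$ is the all-ones and $I$ the identity $n\times n$ matrix (i.e. edge multiplicities add, and every edge of $K_n$ receives net multiplicity $\lambda$).
   Formalization: As stated it fails for K_{a,a} and 2K_a with a≥3 odd (K_{3,3}, λ=3); these are treated as exceptional. For K_a ∪ K_{n-a} the equality with lcm(2,ℓ(G)) fails (n=3, a=1), so only the closed gcd formula is claimed there. Here 1≤a≤n-1. *)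

theory Defs
  imports Complex_Main "HOL-Combinatorics.Permutations"
begin

(* A simple graph on [n] = {1..n} is given by its set of edges, each a two-element subset of [n].
   Matrices in Z^(n x n) are functions nat => nat => int of which only the entries with
   indices in {1..n} matter. *)

definition simple_graph :: "nat \<Rightarrow> nat set set \<Rightarrow> bool" where
  "simple_graph n E \<longleftrightarrow> E \<subseteq> {{i, j} | i j. i \<in> {1..n} \<and> j \<in> {1..n} \<and> i \<noteq> j}"

(* The diagonal entries vanish because the singleton {i, i} is not an edge. *)
definition adj_matrix :: "nat set set \<Rightarrow> nat \<Rightarrow> nat \<Rightarrow> int" where
  "adj_matrix E i j = (if {i, j} \<in> E then 1 else 0)"

definition permuted_copy :: "(nat \<Rightarrow> nat) \<Rightarrow> (nat \<Rightarrow> nat \<Rightarrow> int) \<Rightarrow> nat \<Rightarrow> nat \<Rightarrow> int" where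
  "permuted_copy \<sigma> G i j = G (\<sigma> i) (\<sigma> j)"

definition ones_matrix :: "nat \<Rightarrow> nat \<Rightarrow> int" where
  "ones_matrix i j = 1"

definition id_matrix :: "nat \<Rightarrow> nat \<Rightarrow> int" where
  "id_matrix i j = (if i = j then 1 else 0)"

definition signed_decomposition ::
  "nat \<Rightarrow> nat set set \<Rightarrow> int \<Rightarrow> ((nat \<Rightarrow> nat) \<Rightarrow> int) \<Rightarrow> bool" where
  "signed_decomposition n E lam c \<longleftrightarrow>
    (\<forall>i\<in>{1..n}. \<forall>j\<in>{1..n}.
      (\<Sum>\<sigma> | \<sigma> permutes {1..n}. c \<sigma> * permuted_copy \<sigma> (adj_matrix E) i j)
        = lam * (ones_matrix i j - id_matrix i j))"

definition vertex_degree :: "nat \<Rightarrow> nat set set \<Rightarrow> nat \<Rightarrow> nat" where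
  "vertex_degree n E i = card {j \<in> {1..n}. {i, j} \<in> E}"

definition regular :: "nat \<Rightarrow> nat set set \<Rightarrow> bool" where
  "regular n E \<longleftrightarrow> (\<forall>i\<in>{1..n}. \<forall>j\<in>{1..n}. vertex_degree n E i = vertex_degree n E j)"

definition degree_gcd :: "nat \<Rightarrow> nat set set \<Rightarrow> int" where
  "degree_gcd n E =
    Gcd {int (vertex_degree n E i) - int (vertex_degree n E j) | i j. i \<in> {1..n} \<and> j \<in> {1..n}}"

(* All degrees are congruent modulo their gcd of differences, so vertex 1 is representative;
   see degree_residue_eq. *)
definition degree_residue :: "nat \<Rightarrow> nat set set \<Rightarrow> int" where
  "degree_residue n E = int (vertex_degree n E 1) mod degree_gcd n E"

lemma degree_residue_eq:
  assumes "i \<in> {1..n}"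
  shows "int (vertex_degree n E i) mod degree_gcd n E = degree_residue n E"
proof -
  have "degree_gcd n E dvd int (vertex_degree n E i) - int (vertex_degree n E 1)"
    unfolding degree_gcd_def using assms by (intro Gcd_dvd) force
  then show ?thesis
    unfolding degree_residue_def by (simp add: mod_eq_dvd_iff)
qed

(* The division is exact: twice the number of edges is the sum of the n degrees, each of which
   is congruent to the residue modulo the gcd. *)
definition alpha :: "nat \<Rightarrow> nat set set \<Rightarrow> int" where
  "alpha n E = (if regular n E then 0
     else (2 * int (card E) - degree_residue n E * int n) div degree_gcd n E)"

definition ell :: "nat \<Rightarrow> nat set set \<Rightarrow> int" where
  "ell n E = 2 * int (card E) div
     gcd (int n * (int n - 1)) (gcd (alpha n E * (int n - 1)) (2 * int (card E)))"

definition graph_iso :: "nat \<Rightarrow> nat set set \<Rightarrow> nat set set \<Rightarrow> bool" where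
  "graph_iso n E F \<longleftrightarrow> (\<exists>\<pi>. \<pi> permutes {1..n} \<and> F = (\<lambda>s. \<pi> ` s) ` E)"

definition complete_bipartite :: "nat \<Rightarrow> nat \<Rightarrow> nat set set" where
  "complete_bipartite n a = {{i, j} | i j. i \<in> {1..a} \<and> j \<in> {a+1..n}}"

definition two_cliques :: "nat \<Rightarrow> nat \<Rightarrow> nat set set" where
  "two_cliques n a =
     {{i, j} | i j. i \<in> {1..a} \<and> j \<in> {1..a} \<and> i \<noteq> j} \<union>
     {{i, j} | i j. i \<in> {a+1..n} \<and> j \<in> {a+1..n} \<and> i \<noteq> j}"

(* Sizes a for which K_(a,n-a) and the union of K_a and K_(n-a) do not follow the generic formula.
   Besides n \<noteq> 2 * a these are the balanced cases with a >= 3 odd: every triangle contains an even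
   number of edges of each copy of K_(a,a), so 3 * lam is even, whereas ell is a; likewise for the
   complement, where ell is a - 1 but the least multiplicity is 2 * (a - 1).  For a = 1, n = 2
   the graph K_(1,1) is K_2, with no triangle, and the generic value 1 is right. *)
definition exceptional_size :: "nat \<Rightarrow> nat \<Rightarrow> bool" where
  "exceptional_size n a \<longleftrightarrow> 1 \<le> a \<and> a < n \<and> (n \<noteq> 2 * a \<or> odd a \<and> a \<noteq> 1)"

(* The value for the exceptional graphs.  The gcd divides 2e, since 2e = 2 a (n - a) for
   K_(a,n-a) and 2e = n (n - 1) - 2 a (n - a) for the union of two cliques. *)
definition ell_exceptional :: "nat \<Rightarrow> nat set set \<Rightarrow> nat \<Rightarrow> int" where
  "ell_exceptional n E a = 2 * int (card E) div
     gcd (int n * (int n - 1)) (gcd (int a * (int n - 1)) (int a * (int n - int a)))"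

end

theory Submission
  imports Defs
begin

text \<open>
  Applying two disjoint transpositions to a copy of \<open>G\<close> and taking alternating sums yields a multiple
  of an alternating 4-cycle, with coefficient \<open>G\<^sub>i\<^sub>k - G\<^sub>j\<^sub>k - G\<^sub>i\<^sub>l + G\<^sub>j\<^sub>l\<close>. If some coefficient is
  odd, hence \<open>1\<close> or \<open>-1\<close>, all alternating 4-cycles lie in the lattice spanned by the copies of \<open>G\<close>.
  They span all symmetric hollow matrices with zero row sums, so only a condition on degrees remains,
  and it is equivalent to \<open>\<ell>(G)\<close> dividing \<open>\<lambda>\<close>. If all coefficients are even, \<open>G\<close> is congruent modulo 2 to
  a matrix \<open>f(i) + f(j)\<close> or its complement, so \<open>G\<close> is a cut or a disjoint union of two cliques.

  A copy of a cut has entries \<open>x + y - 2xy\<close> with \<open>x, y\<close> indicator values of one side, of size \<open>a\<close>.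
  For the exceptional sizes this turns decompositions into signed 2-designs with blocks of size \<open>a\<close>;
  two cliques are the complement. The generic case, applied to a clique of size \<open>a\<close> together with
  isolated vertices, shows that signed 2-designs exist whenever the divisibility conditions hold.
\<close>

section \<open>The lattice spanned by the permuted copies of a matrix\<close>

text \<open>In a cut every coefficient is 0, 2 or -2, so the double transposition yields alternating
  4-cycles only with even multiplicity, and the degree condition need not suffice. Triangles detect
  the defect: a copy of a cut contains an even number of edges of each triangle, so lam is even. A
  copy of two cliques contains an odd number, so lam is only congruent modulo 2 to the sum T of the
  coefficients. No factor 2 is forced there: on three vertices a single edge, which is K_1 together
  with K_2, gives lam = 1. This is why the value for two cliques is \<open>ell_exceptional\<close>
  and not an lcm with 2. When n = 2a all degrees agree, and the degree condition no longer controls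
  how often a vertex lies on the side of size a. For odd a > 1 parity restores this control. For
  even a the degree condition already forces a to divide lam for the cut, and a - 1 to divide lam
  for the two cliques, and one explicit combination attains these values.\<close>

definition signed_sum ::
  "'a set \<Rightarrow> (('a \<Rightarrow> 'a) \<Rightarrow> int) \<Rightarrow> ('a \<Rightarrow> 'a \<Rightarrow> int) \<Rightarrow> 'a \<Rightarrow> 'a \<Rightarrow> int" where
  "signed_sum V c G i j = (\<Sum>\<sigma> | \<sigma> permutes V. c \<sigma> * G (\<sigma> i) (\<sigma> j))"

text \<open>Only the entries with both indices in \<open>V\<close> are constrained, so total
  functions serve as matrices and membership ignores their values elsewhere.\<close>

definition copy_span :: "'a set \<Rightarrow> ('a \<Rightarrow> 'a \<Rightarrow> int) \<Rightarrow> ('a \<Rightarrow> 'a \<Rightarrow> int) set" where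
  "copy_span V G = {M. \<exists>c. \<forall>i\<in>V. \<forall>j\<in>V. signed_sum V c G i j = M i j}"

definition hollow_symmetric :: "('a \<Rightarrow> 'a \<Rightarrow> int) \<Rightarrow> bool" where
  "hollow_symmetric G \<longleftrightarrow> (\<forall>i j. G i j = G j i) \<and> (\<forall>i. G i i = 0)"

definition off_diagonal :: "int \<Rightarrow> 'a \<Rightarrow> 'a \<Rightarrow> int" where
  "off_diagonal lam i j = (if i = j then 0 else lam)"

lemma copy_spanI:
  "(\<And>i j. i \<in> V \<Longrightarrow> j \<in> V \<Longrightarrow> signed_sum V c G i j = M i j) \<Longrightarrow> M \<in> copy_span V G"
  by (auto simp: copy_span_def)

lemma copy_span_cong:
  assumes "M \<in> copy_span V G" "\<And>i j. i \<in> V \<Longrightarrow> j \<in> V \<Longrightarrow> M i j = M' i j"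
  shows "M' \<in> copy_span V G"
  using assms by (auto simp: copy_span_def)

lemma signed_sum_base_cong:
  assumes "\<And>i j. i \<in> V \<Longrightarrow> j \<in> V \<Longrightarrow> G i j = G' i j" "i \<in> V" "j \<in> V"
  shows "signed_sum V c G i j = signed_sum V c G' i j"
  unfolding signed_sum_def
  by (intro sum.cong refl) (use assms in \<open>auto simp: permutes_in_image\<close>)

text \<open>An adjacency matrix agrees with \<open>cut_matrix A\<close> or
  \<open>clique_pair_matrix A\<close> only on the vertex set, since the latter two need not vanish
  outside it; this lemma bridges the gap.\<close>

lemma copy_span_base_cong:
  assumes "\<And>i j. i \<in> V \<Longrightarrow> j \<in> V \<Longrightarrow> G i j = G' i j"
  shows "copy_span V G = copy_span V G'"
  using signed_sum_base_cong[of V G G', OF assms] by (simp add: copy_span_def)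

lemma copy_span_add:
  assumes "M \<in> copy_span V G" "N \<in> copy_span V G"
  shows "(\<lambda>i j. M i j + N i j) \<in> copy_span V G"
proof -
  obtain c where c: "\<And>i j. i \<in> V \<Longrightarrow> j \<in> V \<Longrightarrow> signed_sum V c G i j = M i j"
    using assms(1) by (auto simp: copy_span_def)
  obtain d where d: "\<And>i j. i \<in> V \<Longrightarrow> j \<in> V \<Longrightarrow> signed_sum V d G i j = N i j"
    using assms(2) by (auto simp: copy_span_def)
  show ?thesis
    by (rule copy_spanI[of _ "\<lambda>\<sigma>. c \<sigma> + d \<sigma>"])
      (simp add: c[symmetric] d[symmetric] signed_sum_def algebra_simps sum.distrib)
qed

lemma copy_span_scale:
  assumes "M \<in> copy_span V G"
  shows "(\<lambda>i j. m * M i j) \<in> copy_span V G"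
proof -
  obtain c where c: "\<And>i j. i \<in> V \<Longrightarrow> j \<in> V \<Longrightarrow> signed_sum V c G i j = M i j"
    using assms by (auto simp: copy_span_def)
  show ?thesis
    by (rule copy_spanI[of _ "\<lambda>\<sigma>. m * c \<sigma>"])
      (simp add: c[symmetric] signed_sum_def sum_distrib_left mult.assoc)
qed

lemma copy_span_diff:
  assumes "M \<in> copy_span V G" "N \<in> copy_span V G"
  shows "(\<lambda>i j. M i j - N i j) \<in> copy_span V G"
  using copy_span_add[OF assms(1) copy_span_scale[OF assms(2), of "-1"]] by simp

lemma copy_span_zero: "(\<lambda>i j. 0) \<in> copy_span V G"
  by (rule copy_spanI[of _ "\<lambda>\<sigma>. 0"]) (simp add: signed_sum_def)

lemma copy_span_sum:
  assumes "\<And>k. k \<in> K \<Longrightarrow> f k \<in> copy_span V G"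
  shows "(\<lambda>i j. \<Sum>k\<in>K. f k i j) \<in> copy_span V G"
  using assms
  by (induction K rule: infinite_finite_induct) (auto simp: copy_span_zero copy_span_add)

lemma sum_permutations_single:
  assumes "finite V" "\<tau> permutes V"
  shows "(\<Sum>\<sigma> | \<sigma> permutes V. (if \<sigma> = \<tau> then x else 0) * f \<sigma>) = (x * f \<tau> :: int)"
proof -
  have "(\<Sum>\<sigma> | \<sigma> permutes V. (if \<sigma> = \<tau> then x else 0) * f \<sigma>)
      = (\<Sum>\<sigma> | \<sigma> permutes V. if \<sigma> = \<tau> then x * f \<sigma> else 0)"
    by (intro sum.cong) auto
  then show ?thesis
    using assms by (simp add: finite_permutations)
qed

lemma copy_span_copy:
  assumes "finite V" "\<tau> permutes V"
  shows "(\<lambda>i j. G (\<tau> i) (\<tau> j)) \<in> copy_span V G"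
  by (rule copy_spanI[of _ "\<lambda>\<sigma>. if \<sigma> = \<tau> then 1 else 0"])
    (simp add: signed_sum_def sum_permutations_single[OF assms])

lemma copy_span_base: "finite V \<Longrightarrow> G \<in> copy_span V G"
  using copy_span_copy[of V id G] by (simp add: permutes_id)

text \<open>Composing every \<sigma> with \<tau> only reindexes the sum over all permutations. The
  lattice is thus stable under relabelling, so differences of copies can themselves be permuted and
  subtracted again.\<close>

lemma copy_span_permute:
  assumes "M \<in> copy_span V G" "\<tau> permutes V"
  shows "(\<lambda>i j. M (\<tau> i) (\<tau> j)) \<in> copy_span V G"
proof -
  obtain c where c: "\<And>i j. i \<in> V \<Longrightarrow> j \<in> V \<Longrightarrow> signed_sum V c G i j = M i j"
    using assms(1) by (auto simp: copy_span_def)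
  have "signed_sum V (\<lambda>\<sigma>. c (\<sigma> \<circ> inv \<tau>)) G i j = M (\<tau> i) (\<tau> j)" if "i \<in> V" "j \<in> V" for i j
  proof -
    have "\<sigma> \<circ> \<tau> \<circ> inv \<tau> = \<sigma>" for \<sigma> :: "'a \<Rightarrow> 'a"
      using permutes_inv_o(1)[OF assms(2)] by (simp add: comp_assoc)
    then have "signed_sum V (\<lambda>\<sigma>. c (\<sigma> \<circ> inv \<tau>)) G i j = signed_sum V c G (\<tau> i) (\<tau> j)"
      unfolding signed_sum_def by (subst sum_permutations_compose_right[OF assms(2)]) simp
    then show ?thesis
      using c that assms(2) by (simp add: permutes_in_image)
  qed
  then show ?thesis
    by (rule copy_spanI)
qed

lemma hollow_symmetric_diff:
  "hollow_symmetric M \<Longrightarrow> hollow_symmetric N \<Longrightarrow> hollow_symmetric (\<lambda>i j. M i j - N i j)"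
  by (simp add: hollow_symmetric_def)

lemma hollow_symmetric_scale:
  "hollow_symmetric M \<Longrightarrow> hollow_symmetric (\<lambda>i j. m * M i j)"
  by (simp add: hollow_symmetric_def)

lemma hollow_symmetric_sum:
  "(\<And>k. k \<in> K \<Longrightarrow> hollow_symmetric (f k)) \<Longrightarrow> hollow_symmetric (\<lambda>i j. \<Sum>k\<in>K. f k i j)"
  by (auto simp: hollow_symmetric_def intro: sum.cong)

lemma hollow_symmetric_permute:
  "hollow_symmetric M \<Longrightarrow> hollow_symmetric (\<lambda>i j. M (\<tau> i) (\<tau> j))"
  by (simp add: hollow_symmetric_def)

section \<open>Alternating 4-cycles\<close>

definition edge_matrix :: "'a \<Rightarrow> 'a \<Rightarrow> 'a \<Rightarrow> 'a \<Rightarrow> int" where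
  "edge_matrix a b x y = (if {x, y} = {a, b} then 1 else 0)"

definition alternating_cycle :: "'a \<Rightarrow> 'a \<Rightarrow> 'a \<Rightarrow> 'a \<Rightarrow> 'a \<Rightarrow> 'a \<Rightarrow> int" where
  "alternating_cycle i j k l x y =
     edge_matrix i k x y - edge_matrix j k x y - edge_matrix i l x y + edge_matrix j l x y"

text \<open>With \<tau> and \<rho> acting on matrices, the left side is (1 - \<tau>)(1 - \<rho>)
  applied to \<open>G\<close>. The transpositions commute, so a pair fixed by either of them
  contributes zero; the edges moved by both are exactly those joining {i, j} to {k, l}.\<close>

lemma double_transposition_difference:
  fixes G :: "'a \<Rightarrow> 'a \<Rightarrow> int"
  assumes G: "hollow_symmetric G" and d: "distinct [i, j, k, l]"
  defines "\<tau> \<equiv> Transposition.transpose i j" and "\<rho> \<equiv> Transposition.transpose k l"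
  shows "G x y - G (\<tau> x) (\<tau> y) - (G (\<rho> x) (\<rho> y) - G (\<tau> (\<rho> x)) (\<tau> (\<rho> y)))
    = (G i k - G j k - G i l + G j l) * alternating_cycle i j k l x y"
proof -
  have s: "\<And>a b. G a b = G b a" and z: "\<And>a. G a a = 0"
    using G by (auto simp: hollow_symmetric_def)
  have n: "i \<noteq> j" "i \<noteq> k" "i \<noteq> l" "j \<noteq> k" "j \<noteq> l" "k \<noteq> l" "j \<noteq> i" "k \<noteq> i" "l \<noteq> i" "k \<noteq> j" "l \<noteq> j" "l \<noteq> k"
    using d by auto
  have X: "x = i \<or> x = j \<or> x = k \<or> x = l \<or> (x \<noteq> i \<and> x \<noteq> j \<and> x \<noteq> k \<and> x \<noteq> l)" by auto
  have Y: "y = i \<or> y = j \<or> y = k \<or> y = l \<or> (y \<noteq> i \<and> y \<noteq> j \<and> y \<noteq> k \<and> y \<noteq> l)" by auto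
  have S: "G j i = G i j" "G k i = G i k" "G l i = G i l" "G k j = G j k" "G l j = G j l" "G l k = G k l"
    using s by auto
  show ?thesis
    using X Y 
    unfolding \<tau>_def \<rho>_def alternating_cycle_def edge_matrix_def Transposition.transpose_def
    by (elim disjE; simp add: doubleton_eq_iff z n S)
qed

lemma alternating_cycle_in_span:
  assumes V: "finite V" and M: "M \<in> copy_span V G" "hollow_symmetric M"
    and ijkl: "distinct [i, j, k, l]" "{i, j, k, l} \<subseteq> V"
    and unit: "\<bar>M i k - M j k - M i l + M j l\<bar> = 1"
  shows "alternating_cycle i j k l \<in> copy_span V G"
proof -
  let ?v = "M i k - M j k - M i l + M j l"
  let ?D = "\<lambda>x y. M x y - M (Transposition.transpose i j x) (Transposition.transpose i j y)"
  have p: "Transposition.transpose i j permutes V" "Transposition.transpose k l permutes V"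
    using ijkl(2) by (auto intro: permutes_swap_id)
  have D: "?D \<in> copy_span V G"
    by (rule copy_span_diff[OF M(1) copy_span_permute[OF M(1) p(1)]])
  have "(\<lambda>x y. ?v * alternating_cycle i j k l x y) \<in> copy_span V G"
    using copy_span_diff[OF D copy_span_permute[OF D p(2)]]
    by (simp only: double_transposition_difference[OF M(2) ijkl(1)])
  from copy_span_scale[OF this, of ?v]
  have "(\<lambda>x y. ?v * ?v * alternating_cycle i j k l x y) \<in> copy_span V G"
    by (simp add: mult.assoc)
  moreover have "?v * ?v = 1"
    using unit by (metis abs_mult_self_eq mult_1)
  ultimately show ?thesis
    by simp
qed

section \<open>Alternating 4-cycles as generators of the hollow symmetric matrices with zero row
  sums\<close>

lemma hollow_symmetric_alternating_cycle:
  "distinct [i, j, k, l] \<Longrightarrow> hollow_symmetric (alternating_cycle i j k l)"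
  by (auto simp: hollow_symmetric_def alternating_cycle_def edge_matrix_def insert_commute)

lemma edge_matrix_row_sum:
  assumes "finite V" "a \<in> V" "b \<in> V" "a \<noteq> b"
  shows "(\<Sum>y\<in>V. edge_matrix a b x y) = of_bool (x = a) + of_bool (x = b)"
proof -
  have "edge_matrix a b x y = (if y = b then of_bool (x = a) else 0) + (if y = a then of_bool (x = b) else 0)" for y
    using assms(4) by (auto simp: edge_matrix_def doubleton_eq_iff)
  then show ?thesis
    using assms by (simp add: sum.distrib)
qed

lemma alternating_cycle_row_sum:
  assumes "finite V" "{i, j, k, l} \<subseteq> V" "distinct [i, j, k, l]"
  shows "(\<Sum>y\<in>V. alternating_cycle i j k l x y) = 0"
  using assms by (simp add: alternating_cycle_def sum.distrib sum_subtractf edge_matrix_row_sum)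

lemma alternating_cycle_outside:
  assumes "{i, j, k, l} \<subseteq> W" "x \<notin> W \<or> y \<notin> W"
  shows "alternating_cycle i j k l x y = 0"
proof -
  have "{x, y} \<noteq> {a, b}" if "{a, b} \<subseteq> W" for a b
    using assms(2) that by auto
  then show ?thesis
    using assms(1) by (simp add: alternating_cycle_def edge_matrix_def)
qed

text \<open>On three points the row equations make any two of the three entries opposite, so all
  vanish. This is where the clearing of rows stops: fewer than four vertices carry no alternating
  4-cycle.\<close>

lemma zero_row_sums_small:
  assumes X: "hollow_symmetric X" and W: "finite W" "card W \<le> 3"
    and rows: "\<And>i. i \<in> W \<Longrightarrow> (\<Sum>j\<in>W. X i j) = 0"
    and "i \<in> W" "j \<in> W"
  shows "X i j = 0"
proof (cases "i = j")
  case True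
  then show ?thesis using X by (simp add: hollow_symmetric_def)
next
  case False
  have s: "\<And>a b. X a b = X b a" and z: "\<And>a. X a a = 0"
    using X by (auto simp: hollow_symmetric_def)
  have ins: "W = insert i (insert j (W - {i, j}))"
    using assms(5,6) by auto
  have "card (W - {i, j}) \<le> 1"
    using W assms(5,6) False by (simp add: card_Diff_subset)
  then consider "W - {i, j} = {}" | k where "W - {i, j} = {k}"
    using W(1) by (metis card_1_singletonE card_0_eq finite_Diff le_SucE le_zero_eq One_nat_def)
  then show ?thesis
  proof cases
    case 1
    then have "W = {i, j}" using assms(5,6) by auto
    then show ?thesis using rows[of i] False z by simp
  next
    case (2 k)
    then have k: "k \<noteq> i" "k \<noteq> j" and Wk: "W = {i, j, k}" using ins by auto
    show ?thesis
      using rows[of i] rows[of j] rows[of k] k False unfolding Wk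
      by (simp add: z s[of j i] s[of k i] s[of k j])
  qed
qed

text \<open>The rows are cleared one vertex at a time: a row with zero sum is a combination of alternating
  4-cycles through that vertex, as soon as three other vertices are left.\<close>

lemma zero_row_sums_in_span:
  assumes "finite W" "W \<subseteq> V"
    and cycles: "\<And>i j k l. {i, j, k, l} \<subseteq> V \<Longrightarrow> distinct [i, j, k, l] \<Longrightarrow>
          alternating_cycle i j k l \<in> copy_span V G"
    and "hollow_symmetric X"
    and "\<And>i j. X i j \<noteq> 0 \<Longrightarrow> i \<in> W \<and> j \<in> W"
    and "\<And>i. i \<in> W \<Longrightarrow> (\<Sum>j\<in>W. X i j) = 0"
  shows "X \<in> copy_span V G"
  using assms(1,2,4-)
proof (induction W arbitrary: X rule: finite_induct)
  case empty
  then have "X = (\<lambda>i j. 0)" by blast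
  then show ?case by (simp add: copy_span_zero)
next
  case (insert w W)
  show ?case
  proof (cases "card W \<ge> 3")
    case False
    then have "card (insert w W) \<le> 3" using insert.hyps by simp
    have "X i j = 0" for i j
    proof (rule ccontr)
      assume "X i j \<noteq> 0"
      moreover have "i \<in> insert w W" "j \<in> insert w W"
        using insert.prems(3) calculation by auto
      ultimately show False
        using zero_row_sums_small[OF insert.prems(2) _ \<open>card (insert w W) \<le> 3\<close> insert.prems(4)]
          insert.hyps(1) by blast
    qed
    then have "X = (\<lambda>i j. 0)" by blast
    then show ?thesis by (simp add: copy_span_zero)
  next
    case True
    \<comment> \<open>\<open>p\<close> absorbs the corrections of row \<open>w\<close>: the entry at
      each \<open>k\<close> is shifted to \<open>p\<close> by a 4-cycle through \<open>w\<close>,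
      \<open>k\<close>, \<open>p\<close> and a fourth vertex \<open>f k\<close>, available because
      \<open>W\<close> has at least three elements.\<close>
    then obtain p where p: "p \<in> W" by fastforce
    have "\<exists>l. l \<in> W - {k, p}" for k
    proof (rule ccontr)
      assume "\<not> ?thesis"
      then have "W \<subseteq> {k, p}" by auto
      then have "card W \<le> card {k, p}" by (intro card_mono) auto
      also have "\<dots> \<le> 2" by (simp add: card_insert_if)
      finally show False using True by simp
    qed
    then obtain f where f: "\<And>k. f k \<in> W - {k, p}" by metis
    define C where "C k = alternating_cycle w (f k) k p" for k
    \<comment> \<open>In row \<open>w\<close> the cycle \<open>C k\<close> has entry 1 at
      \<open>k\<close> and -1 at \<open>p\<close>. So row \<open>w\<close> of \<open>Y\<close>
      agrees with that of \<open>X\<close> away from \<open>p\<close>, and at \<open>p\<close> by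
      the zero row sum.\<close>
    define Y where "Y = (\<lambda>i j. \<Sum>k\<in>W - {p}. X w k * C k i j)"
    have fW: "f k \<in> W" "f k \<noteq> k" "f k \<noteq> p" for k using f[of k] by auto
    have wW: "\<And>v. v \<in> W \<Longrightarrow> v \<noteq> w" "w \<noteq> p" "\<And>k. f k \<noteq> w"
      using insert.hyps p fW by auto
    have dist: "distinct [w, f k, k, p]" "{w, f k, k, p} \<subseteq> insert w W" if "k \<in> W - {p}" for k
      using that p fW[of k] wW by auto
    have CV: "C k \<in> copy_span V G" if "k \<in> W - {p}" for k
      unfolding C_def using dist[OF that] insert.prems(1) by (intro cycles) auto
    have Y: "Y \<in> copy_span V G"
      unfolding Y_def by (intro copy_span_sum copy_span_scale CV)
    have hY: "hollow_symmetric Y"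
      unfolding Y_def C_def using dist
      by (intro hollow_symmetric_sum hollow_symmetric_scale hollow_symmetric_alternating_cycle)
    have Ysupp: "Y i j = 0" if "i \<notin> insert w W \<or> j \<notin> insert w W" for i j
      unfolding Y_def
    proof (intro sum.neutral ballI)
      fix k assume k: "k \<in> W - {p}"
      have "C k i j = 0"
        unfolding C_def using k dist[of k] that by (intro alternating_cycle_outside[where W = "insert w W"]) auto
      then show "X w k * C k i j = 0" by simp
    qed
    have rowsY: "(\<Sum>j\<in>insert w W. Y i j) = 0" for i
    proof -
      have "(\<Sum>j\<in>insert w W. Y i j) = (\<Sum>k\<in>W - {p}. X w k * (\<Sum>j\<in>insert w W. C k i j))"
        unfolding Y_def sum_distrib_left by (rule sum.swap)
      also have "\<dots> = 0"
        unfolding C_def using dist insert.hyps(1)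
        by (intro sum.neutral ballI) (simp only: alternating_cycle_row_sum finite_insert mult_zero_right)
      finally show ?thesis .
    qed
    have s: "\<And>a b. X a b = X b a" and z: "\<And>a. X a a = 0"
      using insert.prems(2) by (auto simp: hollow_symmetric_def)
    have Xp: "X w p = - (\<Sum>k\<in>W - {p}. X w k)"
      using insert.prems(4)[of w] insert.hyps p z by (simp add: sum.remove[of W p])
    have row_w: "X w j = Y w j" for j
    proof -
      have C: "C k w j = of_bool (j = k) - of_bool (j = p)" if "k \<in> W - {p}" for k
        using that wW p fW[of k] unfolding C_def alternating_cycle_def edge_matrix_def
        by (auto simp: doubleton_eq_iff)
      have "Y w j = (\<Sum>k\<in>W - {p}. X w k * (of_bool (j = k) - of_bool (j = p)))"
        unfolding Y_def by (intro sum.cong refl) (simp add: C)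
      also have "\<dots> = (\<Sum>k\<in>W - {p}. if k = j then X w k else 0)
          - of_bool (j = p) * (\<Sum>k\<in>W - {p}. X w k)"
        unfolding sum_distrib_left sum_subtractf[symmetric] by (intro sum.cong) auto
      also have "\<dots> = (if j \<in> W - {p} then X w j else 0) + of_bool (j = p) * X w p"
        using insert.hyps Xp by (simp add: sum.delta)
      also have "\<dots> = X w j"
        using insert.prems(3)[of w j] z p wW(1) by auto
      finally show ?thesis by simp
    qed
    let ?X = "\<lambda>i j. X i j - Y i j"
    have "?X \<in> copy_span V G"
    proof (rule insert.IH)
      show "W \<subseteq> V" using insert.prems(1) by simp
      show hX: "hollow_symmetric ?X"
        using insert.prems(2) hY by (rule hollow_symmetric_diff)
      have w0: "?X i j = 0" if "i = w \<or> j = w" for i j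
        using that row_w hX unfolding hollow_symmetric_def by (metis diff_self)
      show "i \<in> W \<and> j \<in> W" if "?X i j \<noteq> 0" for i j
        using that w0[of i j] Ysupp[of i j] insert.prems(3)[of i j]
        by (metis diff_zero insertE)
      show "(\<Sum>j\<in>W. ?X i j) = 0" if "i \<in> W" for i
      proof -
        have "(\<Sum>j\<in>insert w W. ?X i j) = 0"
          using insert.prems(4)[of i] rowsY[of i] that by (simp only: sum_subtractf) simp
        then show ?thesis using w0[of i w] insert.hyps by simp
      qed
    qed
    from copy_span_add[OF this Y] show ?thesis by simp
  qed
qed

section \<open>Transferring degrees\<close>

definition row_sum :: "'a set \<Rightarrow> ('a \<Rightarrow> 'a \<Rightarrow> int) \<Rightarrow> 'a \<Rightarrow> int" where
  "row_sum V G i = (\<Sum>j\<in>V. G i j)"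

definition row_sum_gcd :: "'a set \<Rightarrow> ('a \<Rightarrow> 'a \<Rightarrow> int) \<Rightarrow> int" where
  "row_sum_gcd V G = Gcd {row_sum V G i - row_sum V G j | i j. i \<in> V \<and> j \<in> V}"

text \<open>\<open>T\<close> stands for the sum of the coefficients. All row sums of
  \<open>G\<close> agree modulo \<open>row_sum_gcd V G\<close>, so modulo this number a row sum of a
  combination of copies depends on the coefficients only through \<open>T\<close>.\<close>

definition balanced :: "'a set \<Rightarrow> ('a \<Rightarrow> 'a \<Rightarrow> int) \<Rightarrow> int \<Rightarrow> int \<Rightarrow> bool" where
  "balanced V G lam T \<longleftrightarrow>
     T * (\<Sum>i\<in>V. row_sum V G i) = lam * (int (card V) * (int (card V) - 1)) \<and>
     (\<forall>i\<in>V. row_sum_gcd V G dvd lam * (int (card V) - 1) - T * row_sum V G i)"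

lemma row_sum_permute:
  assumes "\<tau> permutes V"
  shows "row_sum V (\<lambda>i j. G (\<tau> i) (\<tau> j)) x = row_sum V G (\<tau> x)"
  unfolding row_sum_def by (subst sum.permute[OF assms]) (simp add: comp_def)

lemma row_sum_off_diagonal:
  assumes "finite V" "x \<in> V"
  shows "row_sum V (off_diagonal lam) x = lam * (int (card V) - 1)"
proof -
  have "card V > 0"
    using assms by (auto simp: card_gt_0_iff)
  moreover have "row_sum V (off_diagonal lam) x = (\<Sum>j\<in>V - {x}. off_diagonal lam x j)"
    unfolding row_sum_def using assms by (simp add: sum.remove[of V x] off_diagonal_def)
  moreover have "\<dots> = (\<Sum>j\<in>V - {x}. lam)"
    by (intro sum.cong) (auto simp: off_diagonal_def)
  ultimately show ?thesis
    using assms by (simp add: of_nat_diff)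
qed

section \<open>Extending bijections between subsets to permutations\<close>

lemma exists_permutation_extending:
  assumes "finite V" "A \<subseteq> V" "B \<subseteq> V" "bij_betw f A B"
  obtains \<sigma> where "\<sigma> permutes V" "\<And>x. x \<in> A \<Longrightarrow> \<sigma> x = f x"
proof -
  have "card (V - A) = card (V - B)"
    using assms bij_betw_same_card[OF assms(4)] by (simp add: card_Diff_subset finite_subset)
  then obtain g where g: "bij_betw g (V - A) (V - B)"
    using assms(1) by (metis finite_Diff finite_same_card_bij)
  define \<sigma> where "\<sigma> x = (if x \<in> A then f x else if x \<in> V then g x else x)" for x
  have "bij_betw \<sigma> A B"
    using assms(4) by (rule bij_betw_cong[THEN iffD1, rotated]) (simp add: \<sigma>_def)
  moreover have "bij_betw \<sigma> (V - A) (V - B)"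
    using g by (rule bij_betw_cong[THEN iffD1, rotated]) (simp add: \<sigma>_def)
  ultimately have "bij_betw \<sigma> (A \<union> (V - A)) (B \<union> (V - B))"
    by (rule bij_betw_combine) auto
  then have "bij_betw \<sigma> V V"
    using assms(2,3) by (simp add: Un_absorb1)
  then have "\<sigma> permutes V"
    by (rule bij_imp_permutes) (use assms(2) in \<open>auto simp: \<sigma>_def\<close>)
  then show ?thesis
    by (rule that) (simp add: \<sigma>_def)
qed

lemma exists_permutation_lists:
  assumes "finite V" "distinct xs" "distinct ys" "length xs = length ys"
    and "set xs \<subseteq> V" "set ys \<subseteq> V"
  obtains \<sigma> where "\<sigma> permutes V" "map \<sigma> xs = ys"
proof -
  let ?h = "inv_into {..<length xs} ((!) xs)"
  have xs: "bij_betw ((!) xs) {..<length xs} (set xs)"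
    and ys: "bij_betw ((!) ys) {..<length xs} (set ys)"
    using assms by (auto intro: bij_betw_nth)
  have "bij_betw ((!) ys \<circ> ?h) (set xs) (set ys)"
    using bij_betw_inv_into[OF xs] ys by (rule bij_betw_trans)
  then obtain \<sigma> where \<sigma>: "\<sigma> permutes V" "\<And>x. x \<in> set xs \<Longrightarrow> \<sigma> x = ((!) ys \<circ> ?h) x"
    using exists_permutation_extending assms(1,5,6) by metis
  have "map \<sigma> xs = ys"
  proof (rule nth_equalityI)
    fix i assume "i < length (map \<sigma> xs)"
    then show "map \<sigma> xs ! i = ys ! i"
      using \<sigma>(2) bij_betw_inv_into_left[OF xs] by simp
  qed (simp add: assms(4))
  with \<sigma>(1) show ?thesis
    by (rule that)
qed

text \<open>\<open>I\<close> is an ideal of the integers, and Bezout puts the gcd of two members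
  into it; the elements of \<open>A\<close> are adjoined one at a time.\<close>

lemma Gcd_mem_of_closed:
  fixes A :: "int set"
  assumes "finite A" "A \<subseteq> I" "0 \<in> I"
    and "\<And>x y a b. x \<in> I \<Longrightarrow> y \<in> I \<Longrightarrow> a * x + b * y \<in> I"
  shows "Gcd A \<in> I"
  using assms(1,2)
proof (induction A rule: finite_induct)
  case (insert x A)
  have "\<exists>a b. a * x + b * Gcd A = gcd x (Gcd A)"
    by (rule bezout_int)
  then show ?case
    using insert assms(4)[of x "Gcd A"] by (metis Gcd_insert insert_subset)
qed (simp add: assms(3))

text \<open>Take a copy in which \<open>i\<close> sits at \<open>k\<close> and \<open>j\<close> at
  \<open>l\<close>, and subtract its image under the transposition of \<open>k\<close> and
  \<open>l\<close>: this moves \<open>row_sum V G i - row_sum V G j\<close> from \<open>l\<close> to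
  \<open>k\<close> and leaves all other row sums zero. The amounts that can be moved form an ideal,
  so their gcd can be moved too.\<close>

lemma row_sum_transfer:
  assumes V: "finite V" and G: "hollow_symmetric G" and "k \<in> V" "l \<in> V" "k \<noteq> l"
  shows "\<exists>Y\<in>copy_span V G. hollow_symmetric Y \<and>
    (\<forall>x\<in>V. row_sum V Y x = row_sum_gcd V G * (of_bool (x = k) - of_bool (x = l)))"
proof -
  define I where "I = {m. \<exists>Y\<in>copy_span V G. hollow_symmetric Y \<and>
    (\<forall>x\<in>V. row_sum V Y x = m * (of_bool (x = k) - of_bool (x = l)))}"
  have zero: "0 \<in> I"
    unfolding I_def
    by (auto intro!: bexI[of _ "\<lambda>i j. 0"] copy_span_zero simp: hollow_symmetric_def row_sum_def)
  have "row_sum_gcd V G \<in> I"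
    unfolding row_sum_gcd_def
  proof (rule Gcd_mem_of_closed)
    have "{row_sum V G i - row_sum V G j | i j. i \<in> V \<and> j \<in> V}
        = (\<lambda>(i, j). row_sum V G i - row_sum V G j) ` (V \<times> V)"
      by auto
    then show "finite {row_sum V G i - row_sum V G j | i j. i \<in> V \<and> j \<in> V}"
      using V by simp
    have "row_sum V G i - row_sum V G j \<in> I" if ij: "i \<in> V" "j \<in> V" for i j
    proof (cases "i = j")
      case True
      then show ?thesis using zero by simp
    next
      case False
      obtain \<sigma> where "\<sigma> permutes V" "map \<sigma> [k, l] = [i, j]"
        by (rule exists_permutation_lists[OF V, of "[k, l]" "[i, j]"])
          (use assms(3-5) ij False in auto)
      then have \<sigma>: "\<sigma> permutes V" "\<sigma> k = i" "\<sigma> l = j"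
        by auto
      let ?\<tau> = "Transposition.transpose k l"
      have \<tau>: "?\<tau> permutes V"
        using assms(3,4) by (rule permutes_swap_id)
      let ?M = "\<lambda>x y. G (\<sigma> x) (\<sigma> y)"
      let ?Y = "\<lambda>x y. ?M x y - ?M (?\<tau> x) (?\<tau> y)"
      have M: "?M \<in> copy_span V G"
        using V \<sigma>(1) by (rule copy_span_copy)
      have "?Y \<in> copy_span V G"
        by (rule copy_span_diff[OF M copy_span_permute[OF M \<tau>]])
      moreover have "hollow_symmetric ?Y"
        using G by (simp add: hollow_symmetric_def)
      moreover have "row_sum V ?Y x
          = (row_sum V G i - row_sum V G j) * (of_bool (x = k) - of_bool (x = l))" for x
      proof -
        have "row_sum V ?Y x = row_sum V ?M x - row_sum V (\<lambda>x y. ?M (?\<tau> x) (?\<tau> y)) x"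
          by (simp add: row_sum_def sum_subtractf)
        also have "\<dots> = row_sum V G (\<sigma> x) - row_sum V G (\<sigma> (?\<tau> x))"
          by (simp only: row_sum_permute[OF \<tau>, of ?M] row_sum_permute[OF \<sigma>(1)])
        finally show ?thesis
          using \<sigma>(2,3) assms(5) by (cases "x = k"; cases "x = l") auto
      qed
      ultimately show ?thesis
        unfolding I_def by blast
    qed
    then show "{row_sum V G i - row_sum V G j | i j. i \<in> V \<and> j \<in> V} \<subseteq> I"
      by blast
  next
    fix x y a b :: int
    assume "x \<in> I" "y \<in> I"
    then obtain X Y where XY: "X \<in> copy_span V G" "hollow_symmetric X"
        "\<And>v. v \<in> V \<Longrightarrow> row_sum V X v = x * (of_bool (v = k) - of_bool (v = l))"
        "Y \<in> copy_span V G" "hollow_symmetric Y"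
        "\<And>v. v \<in> V \<Longrightarrow> row_sum V Y v = y * (of_bool (v = k) - of_bool (v = l))"
      unfolding I_def by blast
    let ?Z = "\<lambda>i j. a * X i j + b * Y i j"
    have "?Z \<in> copy_span V G"
      using XY by (intro copy_span_add copy_span_scale)
    moreover have "hollow_symmetric ?Z"
      using XY by (simp add: hollow_symmetric_def)
    moreover have "row_sum V ?Z v = (a * x + b * y) * (of_bool (v = k) - of_bool (v = l))"
      if "v \<in> V" for v
    proof -
      have "row_sum V ?Z v = a * row_sum V X v + b * row_sum V Y v"
        by (simp add: row_sum_def sum.distrib sum_distrib_left)
      then show ?thesis
        using XY(3,6) that by (simp add: algebra_simps)
    qed
    ultimately show "a * x + b * y \<in> I"
      unfolding I_def by blast
  qed (fact zero)
  then show ?thesis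
    unfolding I_def by blast
qed

text \<open>\<open>T\<close> times \<open>G\<close> has the right total but wrong row sums. The
  errors are multiples of \<open>row_sum_gcd V G\<close>, so transfers repair them, and what then
  remains has zero row sums.\<close>

lemma off_diagonal_in_span:
  assumes V: "finite V" and G: "hollow_symmetric G"
    and ijkl: "distinct [i, j, k, l]" "{i, j, k, l} \<subseteq> V"
    and unit: "\<bar>G i k - G j k - G i l + G j l\<bar> = 1"
    and bal: "balanced V G lam T"
  shows "off_diagonal lam \<in> copy_span V G"
proof -
  let ?n = "int (card V)"
  \<comment> \<open>One odd coefficient is enough: a permutation carries the given four vertices to
    any other four, and the corresponding copy has the same coefficient there.\<close>
  have cycles: "alternating_cycle i' j' k' l' \<in> copy_span V G"
    if i': "{i', j', k', l'} \<subseteq> V" "distinct [i', j', k', l']" for i' j' k' l'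
  proof -
    obtain \<sigma> where \<sigma>: "\<sigma> permutes V" "map \<sigma> [i, j, k, l] = [i', j', k', l']"
      by (rule exists_permutation_lists[OF V, of "[i, j, k, l]" "[i', j', k', l']"])
        (use ijkl i' in auto)
    then have pre: "inv \<sigma> i' = i" "inv \<sigma> j' = j" "inv \<sigma> k' = k" "inv \<sigma> l' = l"
      by (auto simp: permutes_inv_eq)
    have "(\<lambda>x y. G (inv \<sigma> x) (inv \<sigma> y)) \<in> copy_span V G"
      using \<sigma>(1) V by (intro copy_span_copy permutes_inv)
    moreover have "hollow_symmetric (\<lambda>x y. G (inv \<sigma> x) (inv \<sigma> y))"
      using G by (rule hollow_symmetric_permute)
    moreover have "\<bar>G (inv \<sigma> i') (inv \<sigma> k') - G (inv \<sigma> j') (inv \<sigma> k')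
        - G (inv \<sigma> i') (inv \<sigma> l') + G (inv \<sigma> j') (inv \<sigma> l')\<bar> = 1"
      unfolding pre by (rule unit)
    ultimately show ?thesis
      using V i' by (intro alternating_cycle_in_span)
  qed
  have p: "i \<in> V" using ijkl(2) by simp
  obtain Y where Y: "\<And>x. x \<in> V - {i} \<Longrightarrow> Y x \<in> copy_span V G"
      "\<And>x. x \<in> V - {i} \<Longrightarrow> hollow_symmetric (Y x)"
      "\<And>x y. x \<in> V - {i} \<Longrightarrow> y \<in> V \<Longrightarrow>
         row_sum V (Y x) y = row_sum_gcd V G * (of_bool (y = x) - of_bool (y = i))"
  proof -
    have "\<forall>x\<in>V - {i}. \<exists>Y. Y \<in> copy_span V G \<and> hollow_symmetric Y \<and>
        (\<forall>y\<in>V. row_sum V Y y = row_sum_gcd V G * (of_bool (y = x) - of_bool (y = i)))"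
      using row_sum_transfer[OF V G _ p] by blast
    from bchoice[OF this] show ?thesis
      using that by blast
  qed
  define D where "D x = lam * (?n - 1) - T * row_sum V G x" for x
  obtain z where z: "\<And>x. x \<in> V \<Longrightarrow> D x = row_sum_gcd V G * z x"
  proof -
    have "\<forall>x\<in>V. \<exists>z. D x = row_sum_gcd V G * z"
      using bal unfolding balanced_def D_def dvd_def by blast
    from bchoice[OF this] show ?thesis
      using that by blast
  qed
  \<comment> \<open>The total in \<open>balanced\<close> makes the deficits \<open>D\<close> cancel.
    Transfers between \<open>i\<close> and each other vertex that repair all other rows therefore
    repair row \<open>i\<close> as well.\<close>
  have "(\<Sum>x\<in>V. D x) = ?n * (lam * (?n - 1)) - T * (\<Sum>x\<in>V. row_sum V G x)"
    by (simp add: D_def sum_subtractf sum_distrib_left)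
  also have "\<dots> = 0"
    using bal by (simp add: balanced_def)
  finally have Dp: "D i = - (\<Sum>x\<in>V - {i}. D x)"
    using V p by (simp add: sum.remove)
  define Z where "Z = (\<lambda>a b. \<Sum>x\<in>V - {i}. z x * Y x a b)"
  have ZS: "Z \<in> copy_span V G"
    unfolding Z_def by (intro copy_span_sum copy_span_scale Y)
  have hZ: "hollow_symmetric Z"
    unfolding Z_def by (intro hollow_symmetric_sum hollow_symmetric_scale Y)
  have rZ: "row_sum V Z y = D y" if y: "y \<in> V" for y
  proof -
    have "row_sum V Z y = (\<Sum>x\<in>V - {i}. z x * row_sum V (Y x) y)"
      unfolding Z_def row_sum_def sum_distrib_left by (rule sum.swap)
    also have "\<dots> = (\<Sum>x\<in>V - {i}. D x * (of_bool (y = x) - of_bool (y = i)))"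
      using z Y(3) y by (intro sum.cong refl) simp
    also have "\<dots> = D y"
    proof (cases "y = i")
      case True
      then have "(\<Sum>x\<in>V - {i}. D x * (of_bool (y = x) - of_bool (y = i))) = (\<Sum>x\<in>V - {i}. - D x)"
        by (intro sum.cong) auto
      then show ?thesis
        using Dp True by (simp add: sum_negf)
    next
      case False
      then have "(\<Sum>x\<in>V - {i}. D x * (of_bool (y = x) - of_bool (y = i)))
          = (\<Sum>x\<in>V - {i}. if y = x then D x else 0)"
        by (intro sum.cong) auto
      then show ?thesis
        using False V y by simp
    qed
    finally show ?thesis .
  qed
  \<comment> \<open>\<open>X\<close> is set to zero outside \<open>V\<close> because
    \<open>zero_row_sums_in_span\<close> requires its support to lie in the vertex set.\<close>
  define X where
    "X a b = (if a \<in> V \<and> b \<in> V then off_diagonal lam a b - T * G a b - Z a b else 0)" for a b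
  have "X \<in> copy_span V G"
  proof (rule zero_row_sums_in_span[OF V order_refl cycles])
    show "hollow_symmetric X"
      using hZ G unfolding X_def hollow_symmetric_def off_diagonal_def by auto
    show "a \<in> V \<and> b \<in> V" if "X a b \<noteq> 0" for a b
      using that by (auto simp: X_def split: if_splits)
    show "(\<Sum>b\<in>V. X a b) = 0" if a: "a \<in> V" for a
    proof -
      have "(\<Sum>b\<in>V. X a b) = row_sum V (off_diagonal lam) a - T * row_sum V G a - row_sum V Z a"
        using a by (simp add: X_def row_sum_def sum_subtractf sum_distrib_left)
      then show ?thesis
        using rZ[OF a] row_sum_off_diagonal[OF V a, of lam] by (simp add: D_def)
    qed
  qed
  from copy_span_add[OF this copy_span_add[OF copy_span_scale[OF copy_span_base[OF V], of T] ZS]]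
  show ?thesis
    by (rule copy_span_cong) (simp add: X_def)
qed

section \<open>Necessity of the condition on degrees\<close>

lemma row_sum_of_signed_sum:
  assumes V: "finite V" and i: "i \<in> V"
    and c: "\<And>i j. i \<in> V \<Longrightarrow> j \<in> V \<Longrightarrow> signed_sum V c G i j = off_diagonal lam i j"
  shows "(\<Sum>\<sigma> | \<sigma> permutes V. c \<sigma> * row_sum V G (\<sigma> i)) = lam * (int (card V) - 1)"
proof -
  let ?P = "{\<sigma>. \<sigma> permutes V}"
  have "(\<Sum>\<sigma>\<in>?P. c \<sigma> * row_sum V G (\<sigma> i))
      = (\<Sum>\<sigma>\<in>?P. c \<sigma> * row_sum V (\<lambda>i j. G (\<sigma> i) (\<sigma> j)) i)"
    by (intro sum.cong refl) (simp add: row_sum_permute)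
  also have "\<dots> = (\<Sum>j\<in>V. signed_sum V c G i j)"
    unfolding signed_sum_def row_sum_def sum_distrib_left by (rule sum.swap)
  also have "\<dots> = row_sum V (off_diagonal lam) i"
    unfolding row_sum_def using c i by (intro sum.cong) auto
  finally show ?thesis
    by (simp add: row_sum_off_diagonal[OF V i])
qed

text \<open>Compare the sum of all entries, and one row modulo the gcd of the differences of row sums.\<close>

lemma balanced_of_signed_sum:
  assumes V: "finite V"
    and c: "\<And>i j. i \<in> V \<Longrightarrow> j \<in> V \<Longrightarrow> signed_sum V c G i j = off_diagonal lam i j"
  shows "balanced V G lam (\<Sum>\<sigma> | \<sigma> permutes V. c \<sigma>)"
proof -
  let ?P = "{\<sigma>. \<sigma> permutes V}"
  have row: "(\<Sum>\<sigma>\<in>?P. c \<sigma> * row_sum V G (\<sigma> i)) = lam * (int (card V) - 1)" if "i \<in> V" for i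
    using V that c by (rule row_sum_of_signed_sum)
  have "(\<Sum>\<sigma>\<in>?P. c \<sigma>) * (\<Sum>i\<in>V. row_sum V G i) = (\<Sum>\<sigma>\<in>?P. c \<sigma> * (\<Sum>i\<in>V. row_sum V G (\<sigma> i)))"
    unfolding sum_distrib_right
  proof (intro sum.cong refl)
    fix \<sigma> assume "\<sigma> \<in> ?P"
    then have "(\<Sum>i\<in>V. row_sum V G i) = (\<Sum>i\<in>V. row_sum V G (\<sigma> i))"
      by (subst sum.permute[of \<sigma>]) (auto simp: comp_def)
    then show "c \<sigma> * (\<Sum>i\<in>V. row_sum V G i) = c \<sigma> * (\<Sum>i\<in>V. row_sum V G (\<sigma> i))" by simp
  qed
  also have "\<dots> = (\<Sum>i\<in>V. \<Sum>\<sigma>\<in>?P. c \<sigma> * row_sum V G (\<sigma> i))"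
    unfolding sum_distrib_left by (rule sum.swap)
  also have "\<dots> = (\<Sum>i\<in>V. lam * (int (card V) - 1))"
    by (intro sum.cong refl row)
  also have "\<dots> = lam * (int (card V) * (int (card V) - 1))"
    by simp
  finally have total: "(\<Sum>\<sigma>\<in>?P. c \<sigma>) * (\<Sum>i\<in>V. row_sum V G i) = lam * (int (card V) * (int (card V) - 1))" .
  have "row_sum_gcd V G dvd lam * (int (card V) - 1) - (\<Sum>\<sigma>\<in>?P. c \<sigma>) * row_sum V G i"
    if i: "i \<in> V" for i
  proof -
    have "lam * (int (card V) - 1) - (\<Sum>\<sigma>\<in>?P. c \<sigma>) * row_sum V G i
        = (\<Sum>\<sigma>\<in>?P. c \<sigma> * (row_sum V G (\<sigma> i) - row_sum V G i))"
      unfolding row[OF i, symmetric] by (simp add: sum_distrib_right sum_subtractf right_diff_distrib)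
    moreover have "row_sum_gcd V G dvd row_sum V G (\<sigma> i) - row_sum V G i" if "\<sigma> \<in> ?P" for \<sigma>
    proof -
      have "\<sigma> i \<in> V"
        using that i by (simp add: permutes_in_image)
      then show ?thesis
        unfolding row_sum_gcd_def using i by (intro Gcd_dvd) blast
    qed
    ultimately show ?thesis
      by (auto intro: dvd_sum)
  qed
  then show ?thesis
    using total by (simp add: balanced_def)
qed

section \<open>The generic value\<close>

lemma adj_matrix_hollow_symmetric:
  assumes "simple_graph n E"
  shows "hollow_symmetric (adj_matrix E)"
proof -
  have "{i} \<notin> E" for i
    using assms by (fastforce simp: simple_graph_def)
  then show ?thesis
    by (auto simp: hollow_symmetric_def adj_matrix_def insert_commute)
qed

lemma simple_graph_finite: "simple_graph n E \<Longrightarrow> finite E"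
  unfolding simple_graph_def
  by (rule finite_subset[of _ "Pow {1..n}"]) auto

lemma signed_decomposition_iff:
  "(\<exists>c. signed_decomposition n E lam c) \<longleftrightarrow> off_diagonal lam \<in> copy_span {1..n} (adj_matrix E)"
  unfolding copy_span_def signed_decomposition_def signed_sum_def permuted_copy_def
    ones_matrix_def id_matrix_def off_diagonal_def
  by (simp add: if_distrib[of "\<lambda>x. _ * (1 - x)"] cong: if_cong)

lemma row_sum_adj_matrix: "row_sum {1..n} (adj_matrix E) i = int (vertex_degree n E i)"
  by (simp add: row_sum_def adj_matrix_def vertex_degree_def sum.If_cases Int_def)

lemma row_sum_gcd_adj_matrix: "row_sum_gcd {1..n} (adj_matrix E) = degree_gcd n E"
  unfolding row_sum_gcd_def degree_gcd_def row_sum_adj_matrix ..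

lemma sum_row_sum_adj_matrix:
  assumes "simple_graph n E"
  shows "(\<Sum>i\<in>{1..n}. row_sum {1..n} (adj_matrix E) i) = 2 * int (card E)"
proof -
  let ?V = "{1..n}"
  have fin: "finite E"
    using assms by (rule simple_graph_finite)
  have "adj_matrix E i j = (\<Sum>s\<in>E. of_bool ({i, j} = s))" for i j
    using fin by (simp add: adj_matrix_def of_bool_def)
  then have "(\<Sum>i\<in>?V. row_sum ?V (adj_matrix E) i)
      = (\<Sum>i\<in>?V. \<Sum>j\<in>?V. \<Sum>s\<in>E. of_bool ({i, j} = s))"
    by (simp add: row_sum_def)
  also have "\<dots> = (\<Sum>s\<in>E. \<Sum>i\<in>?V. \<Sum>j\<in>?V. of_bool ({i, j} = s))"
    by (simp only: sum.swap[of _ _ E])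
  also have "\<dots> = (\<Sum>s\<in>E. 2)"
  proof (intro sum.cong refl)
    fix s assume "s \<in> E"
    then obtain a b where s: "s = {a, b}" "a \<in> ?V" "b \<in> ?V" "a \<noteq> b"
      using assms by (auto simp: simple_graph_def)
    have "(\<Sum>i\<in>?V. \<Sum>j\<in>?V. of_bool ({i, j} = s)) = (\<Sum>i\<in>?V. \<Sum>j\<in>?V. edge_matrix a b i j)"
      by (simp add: s(1) edge_matrix_def of_bool_def)
    also have "\<dots> = (\<Sum>i\<in>?V. of_bool (i = a) + of_bool (i = b))"
      using s by (intro sum.cong refl edge_matrix_row_sum) auto
    also have "\<dots> = (\<Sum>i\<in>?V. if i = a then 1 else 0) + (\<Sum>i\<in>?V. if i = b then 1 else 0)"
      by (simp add: sum.distrib of_bool_def)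
    also have "\<dots> = 2"
      using s by simp
    finally show "(\<Sum>i\<in>?V. \<Sum>j\<in>?V. of_bool ({i, j} = s)) = (2 :: int)" .
  qed
  finally show ?thesis by simp
qed

lemma dvd_mult_gcd_iff:
  fixes m x a b :: int
  shows "m dvd x * gcd a b \<longleftrightarrow> m dvd x * a \<and> m dvd x * b"
proof -
  have "m dvd x * gcd a b \<longleftrightarrow> m dvd gcd (x * a) (x * b)"
    by (simp add: gcd_mult_left)
  then show ?thesis by simp
qed

text \<open>The quotient 2e / g, with g the gcd, divides \<open>lam\<close> exactly when 2e divides
  \<open>lam\<close> times g. This splits into one divisibility per entry of the gcd; the one from
  the entry 2e holds for every \<open>lam\<close>.\<close>

lemma ell_dvd_iff:
  assumes "card E > 0"
  shows "ell n E dvd lam \<longleftrightarrow>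
    2 * int (card E) dvd lam * (int n * (int n - 1)) \<and>
    2 * int (card E) dvd lam * (alpha n E * (int n - 1))"
proof -
  have "gcd (int n * (int n - 1)) (gcd (alpha n E * (int n - 1)) (2 * int (card E))) dvd 2 * int (card E)"
    by (meson dvd_trans gcd_dvd2)
  then show ?thesis
    unfolding ell_def using assms by (subst div_dvd_iff_mult) (auto simp: dvd_mult_gcd_iff)
qed

text \<open>The total determines \<open>T\<close> as lam n (n - 1) / 2e. With 2e = r n + q alpha,
  the row condition asks for an integer s with q s = lam (n - 1) - T r; multiplying by n gives n s =
  T alpha, so s is lam alpha (n - 1) / 2e. Integrality of \<open>T\<close> and s are the two
  conditions of \<open>ell_dvd_iff\<close>.\<close>

lemma exists_balanced_iff:
  assumes E: "simple_graph n E" "card E > 0"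
  shows "(\<exists>T. balanced {1..n} (adj_matrix E) lam T) \<longleftrightarrow> ell n E dvd lam"
proof -
  let ?e2 = "2 * int (card E)" and ?n = "int n" and ?d = "\<lambda>i. int (vertex_degree n E i)"
  let ?q = "degree_gcd n E"
  have e: "?e2 > 0" using E(2) by simp
  have total: "(\<Sum>i\<in>{1..n}. ?d i) = ?e2"
    using sum_row_sum_adj_matrix[OF E(1)] unfolding row_sum_adj_matrix .
  have n: "?n > 0"
    using total e by (cases n) auto
  have bal: "balanced {1..n} (adj_matrix E) lam T \<longleftrightarrow>
      T * ?e2 = lam * (?n * (?n - 1)) \<and> (\<forall>i\<in>{1..n}. ?q dvd lam * (?n - 1) - T * ?d i)" for T
    by (simp only: balanced_def total row_sum_gcd_adj_matrix
        row_sum_adj_matrix card_atLeastAtMost diff_Suc_1 add_diff_cancel_right')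
  have ex_iff: "(\<exists>T. T * ?e2 = x) \<longleftrightarrow> ?e2 dvd x" for x
    by (metis dvdE dvd_triv_right mult.commute)
  have one: "1 \<in> {1..n}" using n by simp
  show ?thesis
  proof (cases "regular n E")
    case True
    have d: "?d i = ?d 1" if "i \<in> {1..n}" for i
      using True one that unfolding regular_def by (metis (full_types))
    have "{?d i - ?d j | i j. i \<in> {1..n} \<and> j \<in> {1..n}} \<subseteq> {0}"
    proof
      fix x assume "x \<in> {?d i - ?d j | i j. i \<in> {1..n} \<and> j \<in> {1..n}}"
      then obtain i j where "x = ?d i - ?d j" "i \<in> {1..n}" "j \<in> {1..n}"
        by blast
      then show "x \<in> {0}"
        using d[of i] d[of j] by simp
    qed
    then have q: "?q = 0"
      unfolding degree_gcd_def by (simp add: Gcd_0_iff)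
    have "(\<Sum>i\<in>{1..n}. ?d i) = (\<Sum>i\<in>{1..n}. ?d 1)"
      by (intro sum.cong refl d)
    then have nd: "?n * ?d 1 = ?e2"
      using total by simp
    \<comment> \<open>With \<open>?q = 0\<close> divisibility by \<open>?q\<close> means equality,
      which the total forces because every degree is 2e / n.\<close>
    have "lam * (?n - 1) - T * ?d i = 0" if "T * ?e2 = lam * (?n * (?n - 1))" "i \<in> {1..n}" for T i
    proof -
      have "?n * (lam * (?n - 1) - T * ?d 1) = lam * (?n * (?n - 1)) - T * (?n * ?d 1)"
        by (simp add: algebra_simps)
      also have "\<dots> = 0"
        using that(1) nd by simp
      finally show ?thesis
        using n d[OF that(2)] by simp
    qed
    then have "(\<exists>T. balanced {1..n} (adj_matrix E) lam T) \<longleftrightarrow> (\<exists>T. T * ?e2 = lam * (?n * (?n - 1)))"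
      unfolding bal q by auto
    also have "\<dots> \<longleftrightarrow> ?e2 dvd lam * (?n * (?n - 1))"
      by (rule ex_iff)
    finally show ?thesis
      using True by (simp add: ell_dvd_iff[OF E(2)] alpha_def)
  next
    case False
    let ?r = "degree_residue n E"
    have qd: "?q dvd ?d i - ?r" if "i \<in> {1..n}" for i
      using degree_residue_eq[OF that, of E] by (metis dvd_minus_mod)
    have "?q \<noteq> 0"
    proof
      assume "?q = 0"
      then have "{?d i - ?d j | i j. i \<in> {1..n} \<and> j \<in> {1..n}} \<subseteq> {0}"
        unfolding degree_gcd_def Gcd_0_iff .
      then have sub: "x = 0" if "x \<in> {?d i - ?d j | i j. i \<in> {1..n} \<and> j \<in> {1..n}}" for x
        using that by blast
      have "vertex_degree n E i = vertex_degree n E j" if ij: "i \<in> {1..n}" "j \<in> {1..n}" for i j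
      proof -
        have "?d i - ?d j = 0"
          using ij by (intro sub) blast
        then show ?thesis by simp
      qed
      then show False
        using False unfolding regular_def by blast
    qed
    have "?q dvd (\<Sum>i\<in>{1..n}. ?d i - ?r)"
      by (rule dvd_sum) (use qd in auto)
    also have "(\<Sum>i\<in>{1..n}. ?d i - ?r) = ?e2 - ?r * ?n"
      unfolding sum_subtractf total by simp
    finally have "?q dvd ?e2 - ?r * ?n" .
    then have a: "?e2 = ?r * ?n + ?q * alpha n E"
      using False by (simp add: alpha_def)
    have row: "(?q dvd lam * (?n - 1) - T * ?d i) \<longleftrightarrow> ?q dvd lam * (?n - 1) - T * ?r"
      if "i \<in> {1..n}" for i T
    proof -
      have "lam * (?n - 1) - T * ?r = (lam * (?n - 1) - T * ?d i) + T * (?d i - ?r)"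
        by (simp add: algebra_simps)
      then show ?thesis
        by (simp only: dvd_add_left_iff[OF dvd_mult[OF qd[OF that]]])
    qed
    have key: "?q dvd lam * (?n - 1) - T * ?r \<longleftrightarrow> ?e2 dvd lam * (alpha n E * (?n - 1))"
      if T: "T * ?e2 = lam * (?n * (?n - 1))" for T
    proof
      assume "?q dvd lam * (?n - 1) - T * ?r"
      then obtain s where s: "lam * (?n - 1) - T * ?r = ?q * s" ..
      have "?q * (?n * s) = ?n * (lam * (?n - 1) - T * ?r)"
        unfolding s by (simp add: algebra_simps)
      also have "\<dots> = T * ?e2 - T * ?r * ?n"
        unfolding T by (simp add: algebra_simps)
      also have "\<dots> = ?q * (T * alpha n E)"
        unfolding a by (simp add: algebra_simps)
      finally have ns: "?n * s = T * alpha n E"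
        using \<open>?q \<noteq> 0\<close> by simp
      have "?n * (?e2 * s) = ?e2 * (T * alpha n E)"
        unfolding ns[symmetric] by (simp add: algebra_simps)
      also have "\<dots> = (T * ?e2) * alpha n E"
        by (simp add: algebra_simps)
      also have "\<dots> = ?n * (lam * (alpha n E * (?n - 1)))"
        unfolding T by (simp add: algebra_simps)
      finally have "?e2 * s = lam * (alpha n E * (?n - 1))"
        using n by simp
      then show "?e2 dvd lam * (alpha n E * (?n - 1))"
        by (metis dvd_triv_left)
    next
      assume "?e2 dvd lam * (alpha n E * (?n - 1))"
      then obtain s where s: "lam * (alpha n E * (?n - 1)) = ?e2 * s" ..
      have "?e2 * (?n * s) = ?n * (lam * (alpha n E * (?n - 1)))"
        unfolding s by (simp add: algebra_simps)
      also have "\<dots> = (T * ?e2) * alpha n E"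
        unfolding T by (simp add: algebra_simps)
      also have "\<dots> = ?e2 * (T * alpha n E)"
        by (simp add: algebra_simps)
      finally have ns: "?n * s = T * alpha n E"
        using e by simp
      have "?n * (?q * s) = T * (?q * alpha n E)"
        using ns by (metis mult.assoc mult.commute)
      also have "\<dots> = T * ?e2 - T * ?r * ?n"
        unfolding a by (simp add: algebra_simps)
      also have "\<dots> = ?n * (lam * (?n - 1) - T * ?r)"
        unfolding T by (simp add: algebra_simps)
      finally have "?q * s = lam * (?n - 1) - T * ?r"
        using n by simp
      then show "?q dvd lam * (?n - 1) - T * ?r"
        by (metis dvd_triv_left)
    qed
    have "balanced {1..n} (adj_matrix E) lam T \<longleftrightarrow>
        T * ?e2 = lam * (?n * (?n - 1)) \<and> ?e2 dvd lam * (alpha n E * (?n - 1))" for T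
      using key[of T] row one unfolding bal by blast
    then have "(\<exists>T. balanced {1..n} (adj_matrix E) lam T) \<longleftrightarrow>
        ?e2 dvd lam * (?n * (?n - 1)) \<and> ?e2 dvd lam * (alpha n E * (?n - 1))"
      by (simp only: ex_simps ex_iff)
    then show ?thesis
      by (simp only: ell_dvd_iff[OF E(2)])
  qed
qed

section \<open>Graphs whose alternating 4-cycles are all even\<close>

definition cut_matrix :: "'a set \<Rightarrow> 'a \<Rightarrow> 'a \<Rightarrow> int" where
  "cut_matrix A i j = of_bool ((i \<in> A) \<noteq> (j \<in> A))"

definition clique_pair_matrix :: "'a set \<Rightarrow> 'a \<Rightarrow> 'a \<Rightarrow> int" where
  "clique_pair_matrix A i j = of_bool (i \<noteq> j \<and> (i \<in> A) = (j \<in> A))"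

text \<open>All triangles through a fixed vertex \<open>p\<close> have the same parity, so the neighbourhood of \<open>p\<close>
  determines every other entry.\<close>

lemma cut_or_clique_pair:
  fixes G :: "'a \<Rightarrow> 'a \<Rightarrow> int"
  assumes G: "hollow_symmetric G" and vals: "\<And>i j. G i j = 0 \<or> G i j = 1"
    and p: "p \<in> V"
    and even: "\<And>i j k l. distinct [i, j, k, l] \<Longrightarrow> {i, j, k, l} \<subseteq> V \<Longrightarrow>
        even (G i k - G j k - G i l + G j l)"
  shows "\<exists>A\<subseteq>V. (\<forall>i\<in>V. \<forall>j\<in>V. G i j = cut_matrix A i j) \<or>
                 (\<forall>i\<in>V. \<forall>j\<in>V. G i j = clique_pair_matrix A i j)"
proof -
  have s: "\<And>a b. G a b = G b a" and z: "\<And>a. G a a = 0"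
    using G by (auto simp: hollow_symmetric_def)
  have odd_iff: "odd (G a b) \<longleftrightarrow> G a b = 1" for a b
    using vals[of a b] by auto
  \<comment> \<open>The number of edges in the triangle on \<open>p\<close>, \<open>i\<close>,
    \<open>j\<close>.\<close>
  define tri where "tri i j = G p i + G p j + G i j" for i j
  have tri_sym: "tri i j = tri j i" for i j
    by (simp add: tri_def s[of i j])
  let ?U = "V - {p}"
  \<comment> \<open>Modulo 2 the coefficient on \<open>p\<close>, \<open>i\<close>,
    \<open>j\<close>, \<open>m\<close> is the difference of two triangles sharing the edge
    \<open>p i\<close>. Swapping one vertex at a time connects any two triangles through
    \<open>p\<close>.\<close>
  have step: "even (tri i j) \<longleftrightarrow> even (tri i m)" if "i \<in> ?U" "j \<in> ?U" "m \<in> ?U" "i \<noteq> j" "i \<noteq> m" for i j m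
  proof (cases "j = m")
    case False
    then have "even (G p j - G i j - G p m + G i m)"
      using that p by (intro even) auto
    then show ?thesis
      unfolding tri_def by auto
  qed simp
  have all: "even (tri i j) \<longleftrightarrow> even (tri k m)"
    if "i \<in> ?U" "j \<in> ?U" "k \<in> ?U" "m \<in> ?U" "i \<noteq> j" "k \<noteq> m" for i j k m
  proof (cases "i = m")
    case True
    then show ?thesis using step[of i j k] tri_sym[of k m] that by simp
  next
    case False
    then show ?thesis
      using step[of i j m] step[of m i k] tri_sym[of k m] tri_sym[of i m] that by simp
  qed
  show ?thesis
  proof (cases "\<forall>i\<in>?U. \<forall>j\<in>?U. i \<noteq> j \<longrightarrow> even (tri i j)")
    case True
    \<comment> \<open>Even triangles: the side of \<open>p\<close> consists of its non-neighbours,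
      among them \<open>p\<close> itself.\<close>
    let ?A = "{i \<in> V. G p i = 0}"
    have "G i j = cut_matrix ?A i j" if "i \<in> V" "j \<in> V" for i j
    proof -
      consider "i = j" | "i = p" "j \<noteq> p" | "j = p" "i \<noteq> p" | "i \<in> ?U" "j \<in> ?U" "i \<noteq> j"
        using \<open>i \<in> V\<close> \<open>j \<in> V\<close> by blast
      then show ?thesis
      proof cases
        case 4
        then have "even (tri i j)" using True by blast
        then show ?thesis
          using vals[of p i] vals[of p j] vals[of i j] 4 by (auto simp: cut_matrix_def tri_def)
      qed (use that vals[of i j] z s in \<open>auto simp: cut_matrix_def\<close>)
    qed
    then show ?thesis by (intro exI[of _ ?A]) auto
  next
    case False
    then have odd: "odd (tri i j)" if "i \<in> ?U" "j \<in> ?U" "i \<noteq> j" for i j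
      using all that by blast
    \<comment> \<open>Odd triangles: the clique of \<open>p\<close> consists of \<open>p\<close> and
      its neighbours.\<close>
    let ?A = "insert p {i \<in> V. G p i = 1}"
    have "G i j = clique_pair_matrix ?A i j" if "i \<in> V" "j \<in> V" for i j
    proof -
      consider "i = j" | "i = p" "j \<noteq> p" | "j = p" "i \<noteq> p" | "i \<in> ?U" "j \<in> ?U" "i \<noteq> j"
        using \<open>i \<in> V\<close> \<open>j \<in> V\<close> by blast
      then show ?thesis
      proof cases
        case 4
        then have "odd (tri i j)" by (rule odd)
        then show ?thesis
          using vals[of p i] vals[of p j] vals[of i j] 4 by (auto simp: clique_pair_matrix_def tri_def)
      qed (use that vals[of i j] z s in \<open>auto simp: clique_pair_matrix_def\<close>)
    qed
    then show ?thesis using p by (intro exI[of _ ?A]) auto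
  qed
qed

section \<open>Signed 2-designs\<close>

text \<open>The block of \<sigma> is the preimage of \<open>A\<close>, taken with multiplicity
  \<open>c \<sigma>\<close>. In the usual notation \<open>T\<close> is the number of blocks b,
  \<open>t\<close> the replication number r, and \<open>u\<close> the index of the design.\<close>

definition signed_design ::
  "'a set \<Rightarrow> 'a set \<Rightarrow> (('a \<Rightarrow> 'a) \<Rightarrow> int) \<Rightarrow> int \<Rightarrow> int \<Rightarrow> int \<Rightarrow> bool" where
  "signed_design V A c T t u \<longleftrightarrow>
     (\<Sum>\<sigma> | \<sigma> permutes V. c \<sigma>) = T \<and>
     (\<forall>i\<in>V. (\<Sum>\<sigma> | \<sigma> permutes V. c \<sigma> * of_bool (\<sigma> i \<in> A)) = t) \<and>
     (\<forall>i\<in>V. \<forall>j\<in>V. i \<noteq> j \<longrightarrow>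
        (\<Sum>\<sigma> | \<sigma> permutes V. c \<sigma> * (of_bool (\<sigma> i \<in> A) * of_bool (\<sigma> j \<in> A))) = u)"

text \<open>The classical counts v r = b k of point-block incidences and (v - 1) lambda = (k - 1) r
  of pairs through a point, here for integers of any sign.\<close>

definition design_admissible :: "int \<Rightarrow> int \<Rightarrow> int \<Rightarrow> int \<Rightarrow> int \<Rightarrow> bool" where
  "design_admissible v k T t u \<longleftrightarrow> v * t = k * T \<and> (v - 1) * u = (k - 1) * t"

lemma signed_design_complement:
  assumes "signed_design V A c T t u" and "A \<subseteq> V"
  shows "signed_design V (V - A) c T (T - t) (T - 2 * t + u)"
proof -
  let ?P = "{\<sigma>. \<sigma> permutes V}"
  have neg: "of_bool (\<sigma> i \<in> V - A) = (1 - of_bool (\<sigma> i \<in> A) :: int)" if "\<sigma> \<in> ?P" "i \<in> V" for \<sigma> i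
    using that by (simp add: permutes_in_image)
  have T: "(\<Sum>\<sigma>\<in>?P. c \<sigma>) = T"
    and t: "\<And>i. i \<in> V \<Longrightarrow> (\<Sum>\<sigma>\<in>?P. c \<sigma> * of_bool (\<sigma> i \<in> A)) = t"
    and u: "\<And>i j. i \<in> V \<Longrightarrow> j \<in> V \<Longrightarrow> i \<noteq> j \<Longrightarrow>
      (\<Sum>\<sigma>\<in>?P. c \<sigma> * (of_bool (\<sigma> i \<in> A) * of_bool (\<sigma> j \<in> A))) = u"
    using assms(1) unfolding signed_design_def by blast+
  have "(\<Sum>\<sigma>\<in>?P. c \<sigma> * of_bool (\<sigma> i \<in> V - A)) = T - t" if i: "i \<in> V" for i
  proof -
    have "(\<Sum>\<sigma>\<in>?P. c \<sigma> * of_bool (\<sigma> i \<in> V - A)) = (\<Sum>\<sigma>\<in>?P. c \<sigma> - c \<sigma> * of_bool (\<sigma> i \<in> A))"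
      by (intro sum.cong refl) (simp only: neg[OF _ i] right_diff_distrib mult_1_right)
    then show ?thesis
      by (simp only: sum_subtractf T t[OF i])
  qed
  moreover have "(\<Sum>\<sigma>\<in>?P. c \<sigma> * (of_bool (\<sigma> i \<in> V - A) * of_bool (\<sigma> j \<in> V - A))) = T - 2 * t + u"
    if ij: "i \<in> V" "j \<in> V" "i \<noteq> j" for i j
  proof -
    have "(\<Sum>\<sigma>\<in>?P. c \<sigma> * (of_bool (\<sigma> i \<in> V - A) * of_bool (\<sigma> j \<in> V - A)))
      = (\<Sum>\<sigma>\<in>?P. c \<sigma> - c \<sigma> * of_bool (\<sigma> i \<in> A) - c \<sigma> * of_bool (\<sigma> j \<in> A)
          + c \<sigma> * (of_bool (\<sigma> i \<in> A) * of_bool (\<sigma> j \<in> A)))"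
      by (intro sum.cong refl) (simp only: neg[OF _ ij(1)] neg[OF _ ij(2)] algebra_simps)
    then show ?thesis
      by (simp only: sum.distrib sum_subtractf T t[OF ij(1)] t[OF ij(2)] u[OF ij])
  qed
  ultimately show ?thesis
    unfolding signed_design_def using T by blast
qed

lemma signed_design_singleton:
  assumes V: "finite V" and p: "p \<in> V"
  shows "\<exists>c. signed_design V {p} c (int (card V) * t) t 0"
proof -
  let ?P = "{\<sigma>. \<sigma> permutes V}"
  \<comment> \<open>The transposition of \<open>p\<close> and \<open>q\<close> carries the block {p}
    to {q}; each one-point block is taken \<open>t\<close> times.\<close>
  define c where "c \<sigma> = (\<Sum>q\<in>V. if \<sigma> = Transposition.transpose p q then t else 0)" for \<sigma>
  have c: "(\<Sum>\<sigma>\<in>?P. c \<sigma> * f \<sigma>) = (\<Sum>q\<in>V. t * f (Transposition.transpose p q))" for f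
  proof -
    have "(\<Sum>\<sigma>\<in>?P. c \<sigma> * f \<sigma>)
        = (\<Sum>q\<in>V. \<Sum>\<sigma>\<in>?P. (if \<sigma> = Transposition.transpose p q then t else 0) * f \<sigma>)"
      unfolding c_def sum_distrib_right by (rule sum.swap)
    also have "\<dots> = (\<Sum>q\<in>V. t * f (Transposition.transpose p q))"
      using p by (intro sum.cong refl sum_permutations_single V permutes_swap_id)
    finally show ?thesis .
  qed
  have "(\<Sum>\<sigma>\<in>?P. c \<sigma>) = int (card V) * t"
    using c[of "\<lambda>_. 1"] by simp
  moreover have "(\<Sum>\<sigma>\<in>?P. c \<sigma> * of_bool (\<sigma> i \<in> {p})) = t" if "i \<in> V" for i
  proof -
    have "Transposition.transpose p q i = p \<longleftrightarrow> q = i" for q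
      by (auto simp: Transposition.transpose_def)
    then show ?thesis
      using V that by (simp add: c of_bool_def if_distrib[of "\<lambda>x. t * x"] cong: if_cong)
  qed
  moreover have "(\<Sum>\<sigma>\<in>?P. c \<sigma> * (of_bool (\<sigma> i \<in> {p}) * of_bool (\<sigma> j \<in> {p}))) = 0"
    if "i \<noteq> j" for i j
  proof (intro sum.neutral ballI)
    fix \<sigma> assume "\<sigma> \<in> ?P"
    then have "\<sigma> i \<noteq> \<sigma> j"
      using that by (auto dest: permutes_inj injD)
    then show "c \<sigma> * (of_bool (\<sigma> i \<in> {p}) * of_bool (\<sigma> j \<in> {p})) = 0"
      by auto
  qed
  ultimately show ?thesis
    unfolding signed_design_def by blast
qed

text \<open>For \<open>2 \<le> k \<le> v - 2\<close> this is the generic case applied to a clique on \<open>k\<close> vertices.\<close>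

lemma signed_design_exists:
  assumes V: "finite V" and A: "A \<subseteq> V" "A \<noteq> {}" "A \<noteq> V"
    and adm: "design_admissible (int (card V)) (int (card A)) T t u"
  shows "\<exists>c. signed_design V A c T t u"
proof -
  let ?v = "int (card V)" and ?k = "int (card A)"
  let ?P = "{\<sigma>. \<sigma> permutes V}"
  have finA: "finite A" using A(1) V by (rule finite_subset)
  have vt: "?v * t = ?k * T" and vu: "(?v - 1) * u = (?k - 1) * t"
    using adm by (auto simp: design_admissible_def)
  have k0: "card A > 0" and kv: "card A < card V"
    using A V finA by (auto simp: card_gt_0_iff psubset_card_mono)
  \<comment> \<open>The two extreme sizes are treated directly: a clique on one vertex has no edges,
    and a clique missing a single vertex has all its 4-cycle coefficients zero.\<close>
  consider "card A = 1" | "card (V - A) = 1" | "card A \<ge> 2" "card (V - A) \<ge> 2"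
    using k0 kv A finA by (force simp: card_Diff_subset)
  then show ?thesis
  proof cases
    case 1
    then obtain p where p: "A = {p}" by (metis card_1_singletonE)
    have "u = 0"
      using vu 1 kv by simp
    moreover have "T = ?v * t"
      using vt 1 by simp
    ultimately show ?thesis
      using signed_design_singleton[OF V, of p t] A(1) p by simp
  next
    case 2
    then obtain p where p: "V - A = {p}" by (metis card_1_singletonE)
    have k: "?k = ?v - 1"
      using 2 A(1) finA kv by (simp add: card_Diff_subset)
    have T: "T = ?v * (T - t)"
      using vt unfolding k by (simp add: algebra_simps)
    have "(?v - 1) * u = (?v - 1) * (T - 2 * (T - t))"
    proof -
      have "(?v - 1) * (T - 2 * (T - t)) = 2 * (?v * t) - 2 * t - ?k * T"
        unfolding k by (simp add: algebra_simps)
      also have "\<dots> = ?k * T - 2 * t"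
        using vt by simp
      also have "\<dots> = (?k - 1) * t"
        using vt unfolding k by (simp add: algebra_simps)
      finally show ?thesis
        using vu by simp
    qed
    then have u: "u = T - 2 * (T - t)"
      using k k0 by simp
    obtain c where "signed_design V (V - A) c T (T - t) 0"
      using signed_design_singleton[OF V, of p "T - t"] p T by auto
    then have "signed_design V (V - (V - A)) c T (T - (T - t)) (T - 2 * (T - t) + 0)"
      by (rule signed_design_complement) auto
    moreover have "V - (V - A) = A"
      using A(1) by auto
    ultimately show ?thesis
      using u by auto
  next
    case 3
    define G :: "'a \<Rightarrow> 'a \<Rightarrow> int" where "G i j = of_bool (i \<noteq> j \<and> i \<in> A \<and> j \<in> A)" for i j
    obtain x y where xy: "x \<in> A" "y \<in> A" "x \<noteq> y"
      using 3(1) card_le_Suc0_iff_eq[OF finA] by fastforce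
    obtain x' y' where xy': "x' \<in> V - A" "y' \<in> V - A" "x' \<noteq> y'"
      using 3(2) card_le_Suc0_iff_eq[OF finite_Diff[OF V, of A]] by fastforce
    have row: "row_sum V G i = (?k - 1) * of_bool (i \<in> A)" for i
    proof (cases "i \<in> A")
      case True
      have "row_sum V G i = (\<Sum>j\<in>A - {i}. G i j)"
        unfolding row_sum_def using V A(1) by (intro sum.mono_neutral_right) (auto simp: G_def)
      also have "\<dots> = (\<Sum>j\<in>A - {i}. 1)"
        using True by (intro sum.cong) (auto simp: G_def)
      finally show ?thesis
        using True k0 finA by simp
    qed (simp add: row_sum_def G_def)
    have total: "(\<Sum>i\<in>V. row_sum V G i) = ?k * (?k - 1)"
    proof -
      have "(\<Sum>i\<in>V. row_sum V G i) = (\<Sum>i\<in>A. ?k - 1)"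
        unfolding row using V A(1) by (intro sum.mono_neutral_cong_right) auto
      then show ?thesis by simp
    qed
    have "row_sum_gcd V G dvd row_sum V G x - row_sum V G x'"
      unfolding row_sum_gcd_def using xy xy' A(1) by (intro Gcd_dvd) blast
    then have gcd: "row_sum_gcd V G dvd ?k - 1"
      using xy xy' by (simp add: row)
    have "balanced V G u T"
      unfolding balanced_def
    proof (intro conjI ballI)
      have "T * (?k * (?k - 1)) = (?k - 1) * (?v * t)"
        using vt by simp
      also have "\<dots> = ?v * ((?v - 1) * u)"
        unfolding vu by (rule mult.left_commute)
      also have "\<dots> = u * (?v * (?v - 1))"
        by (simp only: ac_simps)
      finally show "T * (\<Sum>i\<in>V. row_sum V G i) = u * (?v * (?v - 1))"
        by (simp only: total)
      have "u * (?v - 1) - T * row_sum V G i = (?k - 1) * (t - T * of_bool (i \<in> A))" for i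
        using vu by (simp only: row right_diff_distrib ac_simps)
      then show "row_sum_gcd V G dvd u * (?v - 1) - T * row_sum V G i" for i
        using gcd by simp
    qed
    moreover have "hollow_symmetric G"
      by (auto simp: hollow_symmetric_def G_def)
    \<comment> \<open>Both \<open>x\<close>, \<open>x'\<close> and \<open>y\<close>,
      \<open>y'\<close> straddle the clique, so of the four entries only \<open>G x y\<close> is
      nonzero and the coefficient is 1.\<close>
    ultimately have "off_diagonal u \<in> copy_span V G"
      using V xy xy' A(1)
      by (intro off_diagonal_in_span[of V G x x' y y' u T]) (auto simp: G_def)
    then obtain c where c: "\<And>i j. i \<in> V \<Longrightarrow> j \<in> V \<Longrightarrow> signed_sum V c G i j = off_diagonal u i j"
      by (auto simp: copy_span_def)
    \<comment> \<open>The decomposition prescribes only the pair counts. Since k >= 2, total and row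
      sums recover the number of blocks and the replication number by cancelling k (k - 1) and k -
      1.\<close>
    have "(\<Sum>\<sigma>\<in>?P. c \<sigma>) * (?k * (?k - 1)) = T * (?k * (?k - 1))"
      using balanced_of_signed_sum[OF V c] \<open>balanced V G u T\<close> unfolding balanced_def total by metis
    then have "(\<Sum>\<sigma>\<in>?P. c \<sigma>) = T"
      using 3(1) by simp
    moreover have "(\<Sum>\<sigma>\<in>?P. c \<sigma> * of_bool (\<sigma> i \<in> A)) = t" if "i \<in> V" for i
    proof -
      have "(?k - 1) * (\<Sum>\<sigma>\<in>?P. c \<sigma> * of_bool (\<sigma> i \<in> A)) = (\<Sum>\<sigma>\<in>?P. c \<sigma> * row_sum V G (\<sigma> i))"
        by (simp only: row sum_distrib_left ac_simps)
      also have "\<dots> = (?k - 1) * t"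
        using row_sum_of_signed_sum[OF V that c] vu by (simp add: mult.commute)
      finally show ?thesis
        using 3(1) by simp
    qed
    moreover have "(\<Sum>\<sigma>\<in>?P. c \<sigma> * (of_bool (\<sigma> i \<in> A) * of_bool (\<sigma> j \<in> A))) = u"
      if "i \<in> V" "j \<in> V" "i \<noteq> j" for i j
    proof -
      have "(\<Sum>\<sigma>\<in>?P. c \<sigma> * (of_bool (\<sigma> i \<in> A) * of_bool (\<sigma> j \<in> A))) = signed_sum V c G i j"
        unfolding signed_sum_def
      proof (intro sum.cong refl)
        fix \<sigma> assume "\<sigma> \<in> ?P"
        then have "\<sigma> i \<noteq> \<sigma> j"
          using that by (auto dest: permutes_inj injD)
        then show "c \<sigma> * (of_bool (\<sigma> i \<in> A) * of_bool (\<sigma> j \<in> A)) = c \<sigma> * G (\<sigma> i) (\<sigma> j)"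
          by (simp add: G_def)
      qed
      then show ?thesis
        using c that by (simp add: off_diagonal_def)
    qed
    ultimately show ?thesis
      unfolding signed_design_def by blast
  qed
qed

section \<open>Cuts and pairs of cliques\<close>

lemma signed_sum_cut_of_design:
  assumes "signed_design V A c T t u" "i \<in> V" "j \<in> V"
  shows "signed_sum V c (cut_matrix A) i j = off_diagonal (2 * (t - u)) i j"
proof (cases "i = j")
  case True
  then show ?thesis
    by (simp add: signed_sum_def cut_matrix_def off_diagonal_def)
next
  case False
  have "cut_matrix A (\<sigma> i) (\<sigma> j) = of_bool (\<sigma> i \<in> A) + of_bool (\<sigma> j \<in> A)
      - 2 * (of_bool (\<sigma> i \<in> A) * of_bool (\<sigma> j \<in> A))" for \<sigma>
    by (auto simp: cut_matrix_def)
  then have "signed_sum V c (cut_matrix A) i j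
    = (\<Sum>\<sigma> | \<sigma> permutes V. c \<sigma> * of_bool (\<sigma> i \<in> A)) + (\<Sum>\<sigma> | \<sigma> permutes V. c \<sigma> * of_bool (\<sigma> j \<in> A))
      - 2 * (\<Sum>\<sigma> | \<sigma> permutes V. c \<sigma> * (of_bool (\<sigma> i \<in> A) * of_bool (\<sigma> j \<in> A)))"
    unfolding signed_sum_def sum_distrib_left sum.distrib[symmetric] sum_subtractf[symmetric]
    by (intro sum.cong refl) (simp only: right_diff_distrib distrib_left ac_simps)
  then show ?thesis
    using assms False by (simp add: signed_design_def off_diagonal_def)
qed

lemma signed_sum_clique_pair:
  assumes "i \<in> V" "j \<in> V"
  shows "signed_sum V c (clique_pair_matrix A) i j
    = off_diagonal (\<Sum>\<sigma> | \<sigma> permutes V. c \<sigma>) i j - signed_sum V c (cut_matrix A) i j"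
proof (cases "i = j")
  case True
  then show ?thesis
    by (simp add: signed_sum_def clique_pair_matrix_def cut_matrix_def off_diagonal_def)
next
  case False
  have "clique_pair_matrix A (\<sigma> i) (\<sigma> j) = 1 - cut_matrix A (\<sigma> i) (\<sigma> j)" if "\<sigma> permutes V" for \<sigma>
  proof -
    have "\<sigma> i \<noteq> \<sigma> j"
      using that False by (auto dest: permutes_inj injD)
    then show ?thesis
      by (auto simp: clique_pair_matrix_def cut_matrix_def)
  qed
  then have "signed_sum V c (clique_pair_matrix A) i j
      = (\<Sum>\<sigma> | \<sigma> permutes V. c \<sigma> - c \<sigma> * cut_matrix A (\<sigma> i) (\<sigma> j))"
    unfolding signed_sum_def by (intro sum.cong) (auto simp: right_diff_distrib)
  then show ?thesis
    using False by (simp add: signed_sum_def off_diagonal_def sum_subtractf)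
qed

lemma row_sum_cut_matrix:
  assumes "finite V" "A \<subseteq> V"
  shows "row_sum V (cut_matrix A) i = (if i \<in> A then int (card V) - int (card A) else int (card A))"
proof -
  have fin: "finite A" using assms by (auto intro: finite_subset)
  have "row_sum V (cut_matrix A) i = int (card {j \<in> V. (i \<in> A) \<noteq> (j \<in> A)})"
    using assms(1) by (simp add: row_sum_def cut_matrix_def of_bool_def sum.If_cases Int_def)
  also have "{j \<in> V. (i \<in> A) \<noteq> (j \<in> A)} = (if i \<in> A then V - A else A)"
    using assms(2) by auto
  finally show ?thesis
    using assms fin by (simp add: card_Diff_subset card_mono of_nat_diff)
qed

lemma sum_row_sum_cut_matrix:
  assumes "finite V" "A \<subseteq> V"
  shows "(\<Sum>i\<in>V. row_sum V (cut_matrix A) i) = 2 * (int (card A) * (int (card V) - int (card A)))"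
proof -
  have fin: "finite A" using assms by (auto intro: finite_subset)
  have "(\<Sum>i\<in>V. row_sum V (cut_matrix A) i)
      = (\<Sum>i\<in>A. row_sum V (cut_matrix A) i) + (\<Sum>i\<in>V - A. row_sum V (cut_matrix A) i)"
    using sum.subset_diff[OF assms(2,1)] by (metis add.commute)
  also have "\<dots> = (\<Sum>i\<in>A. int (card V) - int (card A)) + (\<Sum>i\<in>V - A. int (card A))"
    by (intro arg_cong2[of _ _ _ _ "(+)"] sum.cong) (auto simp: row_sum_cut_matrix[OF assms])
  also have "\<dots> = 2 * (int (card A) * (int (card V) - int (card A)))"
    using assms fin by (simp add: card_Diff_subset card_mono of_nat_diff algebra_simps)
  finally show ?thesis .
qed

lemma sum_row_sum_clique_pair_matrix:
  assumes "finite V" "A \<subseteq> V"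
  shows "(\<Sum>i\<in>V. row_sum V (clique_pair_matrix A) i)
    = int (card V) * (int (card V) - 1) - 2 * (int (card A) * (int (card V) - int (card A)))"
proof -
  have "clique_pair_matrix A i j = off_diagonal 1 i j - cut_matrix A i j" for i j
    by (auto simp: clique_pair_matrix_def cut_matrix_def off_diagonal_def)
  then have "(\<Sum>i\<in>V. row_sum V (clique_pair_matrix A) i)
      = (\<Sum>i\<in>V. row_sum V (off_diagonal 1) i) - (\<Sum>i\<in>V. row_sum V (cut_matrix A) i)"
    by (simp add: row_sum_def sum_subtractf)
  also have "(\<Sum>i\<in>V. row_sum V (off_diagonal 1) i) = (\<Sum>i\<in>V. int (card V) - 1)"
    using assms(1) by (intro sum.cong) (auto simp: row_sum_off_diagonal)
  finally show ?thesis
    by (simp add: sum_row_sum_cut_matrix[OF assms])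
qed

text \<open>A triangle has zero or two edges in each cut, so the net number of edges on it, 3 lam,
  is even.\<close>

lemma even_of_cut_signed_sum:
  assumes V: "finite V" "card V \<ge> 3"
    and c: "\<And>i j. i \<in> V \<Longrightarrow> j \<in> V \<Longrightarrow> signed_sum V c (cut_matrix A) i j = off_diagonal lam i j"
  shows "even lam"
proof -
  obtain W where "W \<subseteq> V" "card W = 3"
    using V by (meson obtain_subset_with_card_n)
  then obtain x y z where xyz: "x \<in> V" "y \<in> V" "z \<in> V" "x \<noteq> y" "y \<noteq> z" "x \<noteq> z"
    by (auto simp: card_3_iff)
  let ?S = "signed_sum V c (cut_matrix A)"
  have "?S x y + ?S y z + ?S x z = (\<Sum>\<sigma> | \<sigma> permutes V. c \<sigma> *
      (cut_matrix A (\<sigma> x) (\<sigma> y) + cut_matrix A (\<sigma> y) (\<sigma> z) + cut_matrix A (\<sigma> x) (\<sigma> z)))"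
    by (simp add: signed_sum_def sum.distrib distrib_left)
  moreover have "even \<dots>"
    by (intro dvd_sum dvd_mult) (auto simp: cut_matrix_def)
  moreover have "?S x y + ?S y z + ?S x z = 3 * lam"
    using xyz by (simp add: c off_diagonal_def)
  ultimately have "even (3 * lam)"
    by metis
  then show ?thesis
    by simp
qed

text \<open>\<open>T\<close> and lam are given, and only the replication number t is to be found: n
  t = a T must be solvable. The unbalanced case reads t off the degree condition, the balanced one
  gets it from parity. Then u = t - lam / 2 is forced.\<close>

lemma design_admissible_of_even_balanced:
  assumes V: "finite V" and A: "A \<subseteq> V"
    and exc: "exceptional_size (card V) (card A)"
    and bal: "balanced V (cut_matrix A) lam T" and "even lam"
  shows "\<exists>t u. design_admissible (int (card V)) (int (card A)) T t u \<and> lam = 2 * (t - u)"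
proof -
  let ?n = "int (card V)" and ?a = "int (card A)"
  have a: "1 \<le> ?a" "?a < ?n"
    using exc by (auto simp: exceptional_size_def)
  obtain s where s: "lam = 2 * s"
    using \<open>even lam\<close> ..
  have total: "T * (2 * (?a * (?n - ?a))) = lam * (?n * (?n - 1))"
    using bal unfolding balanced_def sum_row_sum_cut_matrix[OF V A] by blast
  have "\<exists>t. ?n * t = ?a * T"
  proof (cases "?n = 2 * ?a")
    case True
    then have "card V = 2 * card A"
      by linarith
    then have "odd ?a"
      using exc by (simp add: exceptional_size_def)
    \<comment> \<open>For n = 2a the equation n t = a T says that \<open>T\<close> is even. This
      follows from a T = lam (n - 1), as lam is even and a odd.\<close>
    have "2 * ?a * (T * ?a) = 2 * ?a * (lam * (?n - 1))"
      using total True by (simp add: algebra_simps)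
    then have "T * ?a = lam * (?n - 1)"
      using a by simp
    then have "even (T * ?a)"
      using \<open>even lam\<close> by simp
    then have "even T"
      using \<open>odd ?a\<close> by simp
    then obtain t where "T = 2 * t" ..
    then show ?thesis
      using True by auto
  next
    case False
    \<comment> \<open>A vertex lying in t blocks has row sum t (n - a) + (T - t) a = a T + (n - 2a)
      t in the combination of cuts, so t is the quotient of \<open>lam * (?n - 1) - T * ?a\<close>
      by n - 2a. This explains the choice of a row outside \<open>A\<close>, whose sum is a.\<close>
    obtain i where i: "i \<in> V - A"
      using a A by (metis DiffI order_less_irrefl subsetI subset_antisym)
    have "?n - 2 * ?a dvd row_sum V (cut_matrix A) i - row_sum V (cut_matrix A) j" for i j
      by (auto simp: row_sum_cut_matrix[OF V A] intro: dvdI[of _ _ "-1"])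
    then have "?n - 2 * ?a dvd row_sum_gcd V (cut_matrix A)"
      unfolding row_sum_gcd_def by (intro Gcd_greatest) auto
    also have "\<dots> dvd lam * (?n - 1) - T * ?a"
      using bal i row_sum_cut_matrix[OF V A, of i] unfolding balanced_def by (metis DiffE)
    finally obtain t where t: "lam * (?n - 1) - T * ?a = (?n - 2 * ?a) * t" ..
    have "(?n - 2 * ?a) * (?n * t) = ?n * (lam * (?n - 1) - T * ?a)"
      unfolding t by (rule mult.left_commute)
    also have "\<dots> = lam * (?n * (?n - 1)) - T * ?a * ?n"
      by (simp add: algebra_simps)
    also have "\<dots> = (?n - 2 * ?a) * (?a * T)"
      unfolding total[symmetric] by (simp add: algebra_simps)
    finally have "?n * t = ?a * T"
      using False by simp
    then show ?thesis ..
  qed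
  then obtain t where t: "?n * t = ?a * T" ..
  have "?n * (2 * ((?n - ?a) * t)) = 2 * (?n - ?a) * (?n * t)"
    by (simp add: algebra_simps)
  also have "\<dots> = T * (2 * (?a * (?n - ?a)))"
    unfolding t by (simp add: algebra_simps)
  also have "\<dots> = ?n * (2 * ((?n - 1) * s))"
    unfolding total s by (simp add: algebra_simps)
  finally have "(?n - ?a) * t = (?n - 1) * s"
    using a by simp
  then have "(?n - 1) * (t - s) = (?a - 1) * t"
    by (simp add: algebra_simps)
  then have "design_admissible ?n ?a T t (t - s) \<and> lam = 2 * (t - (t - s))"
    using t s by (simp add: design_admissible_def)
  then show ?thesis by blast
qed

lemma exceptional_order:
  assumes "exceptional_size n a"
  shows "n \<ge> 3"
proof (rule ccontr)
  assume "\<not> ?thesis"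
  then have "a = 1" "n = 2"
    using assms by (auto simp: exceptional_size_def)
  then show False
    using assms by (simp add: exceptional_size_def)
qed

lemma design_admissible_of_cut_signed_sum:
  assumes V: "finite V" and A: "A \<subseteq> V"
    and exc: "exceptional_size (card V) (card A)"
    and c: "\<And>i j. i \<in> V \<Longrightarrow> j \<in> V \<Longrightarrow> signed_sum V c (cut_matrix A) i j = off_diagonal lam i j"
  shows "even lam \<and> (\<exists>t u. design_admissible (int (card V)) (int (card A))
    (\<Sum>\<sigma> | \<sigma> permutes V. c \<sigma>) t u \<and> lam = 2 * (t - u))"
proof -
  have "even lam"
    using V exceptional_order[OF exc] c by (intro even_of_cut_signed_sum) auto
  then show ?thesis
    using design_admissible_of_even_balanced[OF V A exc balanced_of_signed_sum[OF V c]] by blast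
qed

lemma exceptional_proper:
  assumes "A \<subseteq> V" "exceptional_size (card V) (card A)"
  shows "A \<noteq> {}" "A \<noteq> V"
  using assms by (auto simp: exceptional_size_def)

lemma cut_exceptional_iff:
  assumes V: "finite V" and A: "A \<subseteq> V"
    and exc: "exceptional_size (card V) (card A)"
  shows "off_diagonal lam \<in> copy_span V (cut_matrix A) \<longleftrightarrow>
    (\<exists>T t u. design_admissible (int (card V)) (int (card A)) T t u \<and> lam = 2 * (t - u))"
proof
  assume "off_diagonal lam \<in> copy_span V (cut_matrix A)"
  then obtain c where
    "\<And>i j. i \<in> V \<Longrightarrow> j \<in> V \<Longrightarrow> signed_sum V c (cut_matrix A) i j = off_diagonal lam i j"
    by (auto simp: copy_span_def)
  then show "\<exists>T t u. design_admissible (int (card V)) (int (card A)) T t u \<and> lam = 2 * (t - u)"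
    using design_admissible_of_cut_signed_sum[OF V A exc] by blast
next
  assume "\<exists>T t u. design_admissible (int (card V)) (int (card A)) T t u \<and> lam = 2 * (t - u)"
  then obtain T t u c where "signed_design V A c T t u" "lam = 2 * (t - u)"
    using signed_design_exists[OF V A exceptional_proper[OF A exc]] by blast
  then show "off_diagonal lam \<in> copy_span V (cut_matrix A)"
    using signed_sum_cut_of_design by (intro copy_spanI) fastforce
qed

lemma clique_pair_exceptional_iff:
  assumes V: "finite V" and A: "A \<subseteq> V"
    and exc: "exceptional_size (card V) (card A)"
  shows "off_diagonal lam \<in> copy_span V (clique_pair_matrix A) \<longleftrightarrow>
    (\<exists>T t u. design_admissible (int (card V)) (int (card A)) T t u \<and> lam = T - 2 * (t - u))"
proof
  assume "off_diagonal lam \<in> copy_span V (clique_pair_matrix A)"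
  then obtain c where c:
    "\<And>i j. i \<in> V \<Longrightarrow> j \<in> V \<Longrightarrow> signed_sum V c (clique_pair_matrix A) i j = off_diagonal lam i j"
    by (auto simp: copy_span_def)
  let ?T = "\<Sum>\<sigma> | \<sigma> permutes V. c \<sigma>"
  \<comment> \<open>The same coefficients applied to the complementary cuts give multiplicity
    \<open>?T - lam\<close>, to which the results on cuts apply.\<close>
  have "signed_sum V c (cut_matrix A) i j = off_diagonal (?T - lam) i j" if "i \<in> V" "j \<in> V" for i j
    using signed_sum_clique_pair[OF that, of c A] c[OF that]
    by (cases "i = j") (simp_all add: off_diagonal_def)
  from design_admissible_of_cut_signed_sum[OF V A exc this]
  obtain t u where "design_admissible (int (card V)) (int (card A)) ?T t u" "?T - lam = 2 * (t - u)"
    by blast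
  moreover from this have "lam = ?T - 2 * (t - u)"
    by linarith
  ultimately show "\<exists>T t u. design_admissible (int (card V)) (int (card A)) T t u \<and> lam = T - 2 * (t - u)"
    by blast
next
  assume "\<exists>T t u. design_admissible (int (card V)) (int (card A)) T t u \<and> lam = T - 2 * (t - u)"
  then obtain T t u c where c: "signed_design V A c T t u" and lam: "lam = T - 2 * (t - u)"
    using signed_design_exists[OF V A exceptional_proper[OF A exc]] by blast
  show "off_diagonal lam \<in> copy_span V (clique_pair_matrix A)"
  proof (rule copy_spanI)
    fix i j assume "i \<in> V" "j \<in> V"
    then show "signed_sum V c (clique_pair_matrix A) i j = off_diagonal lam i j"
      using signed_sum_clique_pair[of i V j c A] signed_sum_cut_of_design[OF c] c lam
      by (simp add: signed_design_def off_diagonal_def)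
  qed
qed

text \<open>A signed Hadamard design: on the points other than \<open>p\<close>, a signed design with the parameters
  of a 2-\<open>(2a - 1, a - 1, a/2 - 1)\<close> design, each of whose blocks is extended by \<open>p\<close>.\<close>

lemma balanced_cut_signed_sum:
  assumes V: "finite V" and A: "A \<subseteq> V" and n: "card V = 2 * card A" and even: "even (card A)" "card A > 0"
  shows "\<exists>c. (\<Sum>\<sigma> | \<sigma> permutes V. c \<sigma>) = 2 * int (card A) - 1 \<and>
    (\<forall>i\<in>V. \<forall>j\<in>V. signed_sum V c (cut_matrix A) i j = off_diagonal (int (card A)) i j)"
proof -
  let ?a = "int (card A)"
  have finA: "finite A" using A V by (rule finite_subset)
  obtain p where p: "p \<in> A" using even(2) by fastforce
  obtain b where b: "card A = 2 * b" using even(1) ..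
  have b0: "b > 0" using b even(2) by simp
  let ?V = "V - {p}" and ?A = "A - {p}"
  let ?P = "{\<sigma>. \<sigma> permutes V}" and ?Q = "{\<sigma>. \<sigma> permutes ?V}"
  have cV: "int (card ?V) = 2 * ?a - 1" and cA: "int (card ?A) = ?a - 1"
    using n p A V finA even(2) by (auto simp: of_nat_diff)
  have "card ?A \<noteq> 0" "card ?A \<noteq> card ?V"
    using cV cA b b0 by linarith+
  then have "?A \<noteq> {}" "?A \<noteq> ?V"
    by (metis card.empty, metis)
  moreover have "design_admissible (int (card ?V)) (int (card ?A)) (2 * ?a - 1) (?a - 1) (int b - 1)"
    unfolding cV cA design_admissible_def b by (simp add: algebra_simps)
  ultimately obtain d where d: "signed_design ?V ?A d (2 * ?a - 1) (?a - 1) (int b - 1)"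
    using signed_design_exists[of ?V ?A] V A by blast
  \<comment> \<open>Extending every block by \<open>p\<close> means using only permutations that fix
    \<open>p\<close>, a point of \<open>A\<close>.\<close>
  define c where "c \<sigma> = (if \<sigma> permutes ?V then d \<sigma> else 0)" for \<sigma>
  have QP: "?Q \<subseteq> ?P"
    by (auto intro: permutes_subset)
  have c: "(\<Sum>\<sigma>\<in>?P. c \<sigma> * f \<sigma>) = (\<Sum>\<sigma>\<in>?Q. d \<sigma> * f \<sigma>)" for f
    using QP finite_permutations[OF V] by (intro sum.mono_neutral_cong_right) (auto simp: c_def)
  have fix_p: "\<sigma> p = p" if "\<sigma> \<in> ?Q" for \<sigma>
    using that by (auto simp: permutes_not_in)
  have in_A: "\<sigma> i \<in> ?A \<longleftrightarrow> \<sigma> i \<in> A" if "\<sigma> \<in> ?Q" "i \<in> ?V" for \<sigma> i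
    using that permutes_in_image[of \<sigma> ?V i] by auto
  have T: "(\<Sum>\<sigma>\<in>?Q. d \<sigma>) = 2 * ?a - 1"
    using d by (simp add: signed_design_def)
  have t: "(\<Sum>\<sigma>\<in>?Q. d \<sigma> * of_bool (\<sigma> i \<in> ?A)) = ?a - 1" if "i \<in> ?V" for i
    using d that unfolding signed_design_def by blast
  \<comment> \<open>Since \<open>p\<close> is in every block, a pair containing \<open>p\<close> is
    separated by the T - t = (2a - 1) - (a - 1) = a blocks avoiding its other point. For the
    remaining pairs the value is 2 ((a - 1) - (a/2 - 1)), again a.\<close>
  have sum_p: "(\<Sum>\<sigma>\<in>?Q. d \<sigma> * cut_matrix A (\<sigma> i) (\<sigma> p)) = ?a" if i: "i \<in> ?V" for i
  proof -
    have cut: "cut_matrix A (\<sigma> i) (\<sigma> p) = 1 - of_bool (\<sigma> i \<in> ?A)" if "\<sigma> \<in> ?Q" for \<sigma>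
      unfolding in_A[OF that i] cut_matrix_def fix_p[OF that] using p by simp
    have "(\<Sum>\<sigma>\<in>?Q. d \<sigma> * cut_matrix A (\<sigma> i) (\<sigma> p)) = (\<Sum>\<sigma>\<in>?Q. d \<sigma> - d \<sigma> * of_bool (\<sigma> i \<in> ?A))"
      by (intro sum.cong refl) (simp only: cut right_diff_distrib mult_1_right)
    then show ?thesis
      by (simp only: sum_subtractf T t[OF i])
  qed
  have "signed_sum V c (cut_matrix A) i j = off_diagonal ?a i j" if ij: "i \<in> V" "j \<in> V" for i j
  proof -
    consider "i = j" | "i = p" "j \<in> ?V" | "j = p" "i \<in> ?V" | "i \<noteq> j" "i \<in> ?V" "j \<in> ?V"
      using ij by blast
    then show ?thesis
    proof cases
      case 1
      then show ?thesis
        by (simp add: signed_sum_def cut_matrix_def off_diagonal_def)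
    next
      case 2
      have "signed_sum V c (cut_matrix A) p j = (\<Sum>\<sigma>\<in>?Q. d \<sigma> * cut_matrix A (\<sigma> j) (\<sigma> p))"
        unfolding signed_sum_def c cut_matrix_def by (simp only: eq_commute)
      then show ?thesis
        using 2 sum_p[of j] by (auto simp: off_diagonal_def)
    next
      case 3
      then show ?thesis
        using sum_p[of i] unfolding signed_sum_def c off_diagonal_def by auto
    next
      case 4
      have "signed_sum V c (cut_matrix A) i j = signed_sum ?V d (cut_matrix ?A) i j"
        unfolding signed_sum_def c cut_matrix_def
        by (intro sum.cong refl) (simp only: in_A[OF _ 4(2)] in_A[OF _ 4(3)])
      also have "\<dots> = off_diagonal (2 * ((?a - 1) - (int b - 1))) i j"
        using d 4 by (intro signed_sum_cut_of_design)
      finally show ?thesis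
        using b by simp
    qed
  qed
  moreover have "(\<Sum>\<sigma>\<in>?P. c \<sigma>) = 2 * ?a - 1"
    using c[of "\<lambda>_. 1"] T by simp
  ultimately show ?thesis by blast
qed

section \<open>Sufficiency of the degree condition for n = 2a with a even\<close>

lemma copy_span_off_diagonal_dvd:
  fixes V :: "'a set"
  assumes "off_diagonal x \<in> copy_span V G" "x dvd lam"
  shows "off_diagonal lam \<in> copy_span V G"
proof -
  obtain m where "lam = x * m" using assms(2) ..
  then have "(off_diagonal lam :: 'a \<Rightarrow> 'a \<Rightarrow> int) = (\<lambda>i j. m * off_diagonal x i j)"
    by (auto simp: off_diagonal_def fun_eq_iff)
  then show ?thesis
    using copy_span_scale[OF assms(1), of m] by simp
qed

text \<open>Multiples of a are attained by the signed Hadamard design. Conversely the total gives a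
  T = (2a - 1) lam, and a is coprime to 2a - 1, so a divides lam.\<close>

lemma balanced_cut_in_span:
  assumes V: "finite V" and A: "A \<subseteq> V" and n: "card V = 2 * card A" and even: "even (card A)" "card A > 0"
    and bal: "balanced V (cut_matrix A) lam T"
  shows "off_diagonal lam \<in> copy_span V (cut_matrix A)"
proof (rule copy_span_off_diagonal_dvd)
  show "off_diagonal (int (card A)) \<in> copy_span V (cut_matrix A)"
    using balanced_cut_signed_sum[OF V A n even] by (auto simp: copy_span_def)
  let ?a = "int (card A)"
  have "T * (2 * (?a * (2 * ?a - ?a))) = lam * (2 * ?a * (2 * ?a - 1))"
    using bal n unfolding balanced_def sum_row_sum_cut_matrix[OF V A] by simp
  then have "2 * ?a * (T * ?a) = 2 * ?a * (2 * ?a * lam - lam)"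
    by (simp add: algebra_simps)
  then have "T * ?a = 2 * ?a * lam - lam"
    using even(2) by simp
  then have "lam = ?a * (2 * lam - T)"
    by (simp add: algebra_simps)
  then show "?a dvd lam" by (rule dvdI)
qed

lemma balanced_clique_pair_in_span:
  assumes V: "finite V" and A: "A \<subseteq> V" and n: "card V = 2 * card A" and even: "even (card A)" "card A > 0"
    and bal: "balanced V (clique_pair_matrix A) lam T"
  shows "off_diagonal lam \<in> copy_span V (clique_pair_matrix A)"
proof (rule copy_span_off_diagonal_dvd)
  let ?a = "int (card A)"
  obtain c where c: "(\<Sum>\<sigma> | \<sigma> permutes V. c \<sigma>) = 2 * ?a - 1"
      "\<forall>i\<in>V. \<forall>j\<in>V. signed_sum V c (cut_matrix A) i j = off_diagonal ?a i j"
    using balanced_cut_signed_sum[OF V A n even] by blast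
  \<comment> \<open>Complementing each cut of the signed Hadamard design gives (2a - 1) - a = a -
    1.\<close>
  show "off_diagonal (?a - 1) \<in> copy_span V (clique_pair_matrix A)"
    by (rule copy_spanI[of _ c]) (simp add: signed_sum_clique_pair c off_diagonal_def)
  have "T * (2 * ?a * (2 * ?a - 1) - 2 * (?a * (2 * ?a - ?a))) = lam * (2 * ?a * (2 * ?a - 1))"
    using bal n unfolding balanced_def sum_row_sum_clique_pair_matrix[OF V A] by simp
  then have "2 * ?a * (T * (?a - 1)) = 2 * ?a * (lam * (2 * (?a - 1) + 1))"
    by (simp add: algebra_simps)
  then have "T * (?a - 1) = lam * (2 * (?a - 1) + 1)"
    using even(2) by simp
  then have "lam = (?a - 1) * (T - 2 * lam)"
    by (simp add: algebra_simps)
  then show "?a - 1 dvd lam" by (rule dvdI)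
qed

section \<open>Arithmetic of the exceptional value\<close>

text \<open>Admissible \<open>(T, t, t - u)\<close> are exactly the integer vectors proportional to
  \<open>(n (n - 1), a (n - 1), a (n - a))\<close>. Cuts correspond to \<open>x = 0, y = 2\<close> and pairs of cliques to
  \<open>x = 1, y = -2\<close>.\<close>

lemma design_admissible_iff_dvd:
  fixes n a x y e lam :: int
  assumes e: "e = x * (n * (n - 1)) + y * (a * (n - a))" "e \<noteq> 0" and n: "n > 0"
  shows "(\<exists>T t u. design_admissible n a T t u \<and> lam = x * T + y * (t - u)) \<longleftrightarrow>
    e dvd lam * (n * (n - 1)) \<and> e dvd lam * (a * (n - 1)) \<and> e dvd lam * (a * (n - a))"
proof
  assume "\<exists>T t u. design_admissible n a T t u \<and> lam = x * T + y * (t - u)"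
  then obtain T t u where nt: "n * t = a * T" and "(n - 1) * u = (a - 1) * t"
    and lam: "lam = x * T + y * (t - u)"
    by (auto simp: design_admissible_def)
  then have s: "(n - 1) * (t - u) = (n - a) * t"
    by (simp add: algebra_simps)
  \<comment> \<open>\<open>Tt\<close>, \<open>ts\<close> and \<open>Ts\<close> are the cross
    products expressing the proportionality. \<open>e\<close> is the linear form with coefficients
    \<open>x\<close>, \<open>y\<close> at the model vector and lam its value at (T, t, t - u), so
    lam times the model vector is \<open>e\<close> times (T, t, t - u).\<close>
  have Tt: "T * (a * (n - 1)) = t * (n * (n - 1))"
    using nt by (metis mult.assoc mult.commute)
  have ts: "t * (a * (n - a)) = (t - u) * (a * (n - 1))"
    using s by (metis mult.assoc mult.commute)
  have Ts: "T * (a * (n - a)) = (t - u) * (n * (n - 1))"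
  proof -
    have "T * (a * (n - a)) = (n - a) * (n * t)"
      unfolding nt by (simp only: ac_simps)
    also have "\<dots> = n * ((n - a) * t)"
      by (rule mult.left_commute)
    also have "\<dots> = (t - u) * (n * (n - 1))"
      unfolding s[symmetric] by (simp only: ac_simps)
    finally show ?thesis .
  qed
  have "lam * (n * (n - 1)) = x * (n * (n - 1)) * T + y * ((t - u) * (n * (n - 1)))"
    unfolding lam by algebra
  then have "lam * (n * (n - 1)) = e * T"
    unfolding Ts[symmetric] e by algebra
  moreover have "lam * (a * (n - 1)) = x * (T * (a * (n - 1))) + y * ((t - u) * (a * (n - 1)))"
    unfolding lam by algebra
  then have "lam * (a * (n - 1)) = e * t"
    unfolding Tt ts[symmetric] e by algebra
  moreover have "lam * (a * (n - a)) = x * (T * (a * (n - a))) + y * ((t - u) * (a * (n - a)))"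
    unfolding lam by algebra
  then have "lam * (a * (n - a)) = e * (t - u)"
    unfolding Ts e by algebra
  ultimately show "e dvd lam * (n * (n - 1)) \<and> e dvd lam * (a * (n - 1)) \<and> e dvd lam * (a * (n - a))"
    by simp
next
  assume "e dvd lam * (n * (n - 1)) \<and> e dvd lam * (a * (n - 1)) \<and> e dvd lam * (a * (n - a))"
  then obtain T t s where T: "lam * (n * (n - 1)) = e * T" and t: "lam * (a * (n - 1)) = e * t"
    and s: "lam * (a * (n - a)) = e * s"
    unfolding dvd_def by blast
  have "e * (n * t) = n * (lam * (a * (n - 1)))"
    unfolding t by (simp only: ac_simps)
  also have "\<dots> = a * (lam * (n * (n - 1)))"
    by (simp only: ac_simps)
  also have "\<dots> = e * (a * T)"
    unfolding T by (simp only: ac_simps)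
  finally have nt: "n * t = a * T"
    using e(2) by simp
  have "e * ((n - 1) * s) = (n - 1) * (lam * (a * (n - a)))"
    unfolding s by (simp only: ac_simps)
  also have "\<dots> = (n - a) * (lam * (a * (n - 1)))"
    by (simp only: ac_simps)
  also have "\<dots> = e * ((n - a) * t)"
    unfolding t by (simp only: ac_simps)
  finally have "(n - 1) * s = (n - a) * t"
    using e(2) by simp
  then have "(n - 1) * (t - s) = (a - 1) * t"
    by (simp add: algebra_simps)
  with nt have adm: "design_admissible n a T t (t - s)"
    by (simp add: design_admissible_def)
  have "e * lam = x * (lam * (n * (n - 1))) + y * (lam * (a * (n - a)))"
    unfolding e by algebra
  also have "\<dots> = e * (x * T + y * s)"
    unfolding T s by algebra
  finally have "lam = x * T + y * (t - (t - s))"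
    using e(2) by simp
  with adm show "\<exists>T t u. design_admissible n a T t u \<and> lam = x * T + y * (t - u)"
    by blast
qed

text \<open>The quotient is exact because 2e is an integer combination of two entries of the gcd,
  with the coefficients \<open>x\<close> and \<open>y\<close>; it remains to distribute the
  divisibility over the three entries.\<close>

lemma ell_exceptional_dvd_iff:
  assumes E: "card E > 0" and n: "n > 0"
    and e: "2 * int (card E) = x * (int n * (int n - 1)) + y * (int a * (int n - int a))"
  shows "ell_exceptional n E a dvd lam \<longleftrightarrow>
    (\<exists>T t u. design_admissible (int n) (int a) T t u \<and> lam = x * T + y * (t - u))"
proof -
  let ?g = "gcd (int n * (int n - 1)) (gcd (int a * (int n - 1)) (int a * (int n - int a)))"
  have "?g dvd int a * (int n - int a)"
    by (meson dvd_trans gcd_dvd2)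
  then have "?g dvd 2 * int (card E)"
    unfolding e by (simp only: dvd_add dvd_mult gcd_dvd1)
  moreover have "?g \<noteq> 0"
    using calculation E by auto
  ultimately have "ell_exceptional n E a dvd lam \<longleftrightarrow> 2 * int (card E) dvd lam * ?g"
    unfolding ell_exceptional_def by (simp only: div_dvd_iff_mult not_False_eq_True)
  also have "\<dots> \<longleftrightarrow> (\<exists>T t u. design_admissible (int n) (int a) T t u \<and> lam = x * T + y * (t - u))"
    using E n by (subst design_admissible_iff_dvd[OF e]) (auto simp: dvd_mult_gcd_iff)
  finally show ?thesis .
qed

text \<open>Mutual divisibility of integers gives equality only up to sign; this fixes the
  sign.\<close>

lemma ell_exceptional_nonneg: "ell_exceptional n E a \<ge> 0"
  unfolding ell_exceptional_def by (rule div_int_pos_iff[THEN iffD2]) auto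

section \<open>Isomorphism with a cut or a pair of cliques\<close>

lemma graph_isoI:
  assumes "simple_graph n E" "simple_graph n F" and \<pi>: "\<pi> permutes {1..n}"
    and iff: "\<And>i j. i \<in> {1..n} \<Longrightarrow> j \<in> {1..n} \<Longrightarrow> {i, j} \<in> E \<longleftrightarrow> {\<pi> i, \<pi> j} \<in> F"
  shows "graph_iso n E F"
  unfolding graph_iso_def
proof (intro exI conjI set_eqI iffI)
  show "\<pi> permutes {1..n}" by fact
next
  fix s assume s: "s \<in> F"
  then obtain x y where xy: "s = {x, y}" "x \<in> {1..n}" "y \<in> {1..n}"
    using assms(2) by (auto simp: simple_graph_def)
  have inv: "\<pi> (inv \<pi> x) = x" "\<pi> (inv \<pi> y) = y"
    using permutes_inverses(1)[OF \<pi>] by auto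
  have "inv \<pi> x \<in> {1..n}" "inv \<pi> y \<in> {1..n}"
    using xy permutes_in_image[OF permutes_inv[OF \<pi>]] by auto
  then have "{inv \<pi> x, inv \<pi> y} \<in> E"
    using iff s xy(1) inv by simp
  then show "s \<in> (\<lambda>s. \<pi> ` s) ` E"
    using xy(1) inv by (intro image_eqI[of _ _ "{inv \<pi> x, inv \<pi> y}"]) auto
next
  fix s assume "s \<in> (\<lambda>s. \<pi> ` s) ` E"
  then obtain r where r: "r \<in> E" "s = \<pi> ` r" by blast
  then obtain x y where xy: "r = {x, y}" "x \<in> {1..n}" "y \<in> {1..n}"
    using assms(1) by (auto simp: simple_graph_def)
  then show "s \<in> F"
    using iff[of x y] r by simp
qed

lemma simple_graph_complete_bipartite: "a \<le> n \<Longrightarrow> simple_graph n (complete_bipartite n a)"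
  unfolding simple_graph_def complete_bipartite_def by fastforce

lemma simple_graph_two_cliques: "a \<le> n \<Longrightarrow> simple_graph n (two_cliques n a)"
  unfolding simple_graph_def two_cliques_def by fastforce

lemma complete_bipartite_iff:
  assumes "x \<in> {1..n}" "y \<in> {1..n}"
  shows "{x, y} \<in> complete_bipartite n a \<longleftrightarrow> (x \<in> {1..a}) \<noteq> (y \<in> {1..a})"
proof
  assume "{x, y} \<in> complete_bipartite n a"
  then show "(x \<in> {1..a}) \<noteq> (y \<in> {1..a})"
    by (auto simp: complete_bipartite_def doubleton_eq_iff)
next
  assume "(x \<in> {1..a}) \<noteq> (y \<in> {1..a})"
  then consider "x \<in> {1..a}" "y \<in> {a + 1..n}" | "y \<in> {1..a}" "x \<in> {a + 1..n}"
    using assms by force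
  then show "{x, y} \<in> complete_bipartite n a"
    unfolding complete_bipartite_def
  proof cases
    case 2
    then have "\<exists>i j. {x, y} = {i, j} \<and> i \<in> {1..a} \<and> j \<in> {a + 1..n}"
      by (intro exI[of _ y] exI[of _ x]) auto
    then show "{x, y} \<in> {{i, j} | i j. i \<in> {1..a} \<and> j \<in> {a + 1..n}}"
      by blast
  qed blast
qed

lemma two_cliques_iff:
  assumes "x \<in> {1..n}" "y \<in> {1..n}"
  shows "{x, y} \<in> two_cliques n a \<longleftrightarrow> x \<noteq> y \<and> (x \<in> {1..a}) = (y \<in> {1..a})"
proof
  assume "{x, y} \<in> two_cliques n a"
  then show "x \<noteq> y \<and> (x \<in> {1..a}) = (y \<in> {1..a})"
    by (auto simp: two_cliques_def doubleton_eq_iff)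
next
  assume "x \<noteq> y \<and> (x \<in> {1..a}) = (y \<in> {1..a})"
  then consider "x \<noteq> y" "x \<in> {1..a}" "y \<in> {1..a}" | "x \<noteq> y" "x \<in> {a + 1..n}" "y \<in> {a + 1..n}"
    using assms by force
  then show "{x, y} \<in> two_cliques n a"
    unfolding two_cliques_def by cases blast+
qed

text \<open>Pulling {1..a} back along the isomorphism turns the standard graph on initial segments
  into a matrix given by an arbitrary vertex subset \<open>A\<close>.\<close>

lemma graph_iso_preimage:
  assumes "graph_iso n E F" "a \<le> n"
  obtains \<pi> A where "A \<subseteq> {1..n}" "card A = a"
    "\<And>i. i \<in> {1..n} \<Longrightarrow> \<pi> i \<in> {1..n}" "\<And>i. i \<in> {1..n} \<Longrightarrow> \<pi> i \<in> {1..a} \<longleftrightarrow> i \<in> A"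
    "\<And>i j. \<pi> i = \<pi> j \<longleftrightarrow> i = j" "\<And>i j. {i, j} \<in> E \<longleftrightarrow> {\<pi> i, \<pi> j} \<in> F"
proof -
  obtain \<pi> where \<pi>: "\<pi> permutes {1..n}" and F: "F = (\<lambda>s. \<pi> ` s) ` E"
    using assms(1) by (auto simp: graph_iso_def)
  have inj: "inj \<pi>" using \<pi> by (rule permutes_inj)
  let ?A = "\<pi> -` {1..a}"
  have sub: "?A \<subseteq> {1..n}"
  proof
    fix i assume "i \<in> ?A"
    then have "\<pi> i \<in> {1..n}" using assms(2) by simp
    then show "i \<in> {1..n}" using permutes_in_image[OF \<pi>] by blast
  qed
  have "card ?A = card {1..a}"
    using permutes_surj[OF \<pi>] by (intro card_vimage_inj inj) auto
  then have "card ?A = a" by simp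
  moreover have "\<pi> i \<in> {1..n}" if "i \<in> {1..n}" for i
    using that permutes_in_image[OF \<pi>] by blast
  moreover have "inj (\<lambda>s. \<pi> ` s)"
    by (rule injI) (simp add: inj_image_eq_iff[OF inj])
  from inj_image_mem_iff[OF this, of "{_, _}" E]
  have "{i, j} \<in> E \<longleftrightarrow> {\<pi> i, \<pi> j} \<in> F" for i j
    by (simp add: F)
  ultimately show ?thesis
    using sub inj by (intro that[of ?A \<pi>]) (auto simp: inj_eq)
qed

lemma adj_matrix_of_iso_complete_bipartite:
  assumes "graph_iso n E (complete_bipartite n a)" "a \<le> n"
  shows "\<exists>A\<subseteq>{1..n}. card A = a \<and> (\<forall>i\<in>{1..n}. \<forall>j\<in>{1..n}. adj_matrix E i j = cut_matrix A i j)"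
proof -
  obtain \<pi> A where A: "A \<subseteq> {1..n}" "card A = a"
    and \<pi>: "\<And>i. i \<in> {1..n} \<Longrightarrow> \<pi> i \<in> {1..n}" "\<And>i. i \<in> {1..n} \<Longrightarrow> \<pi> i \<in> {1..a} \<longleftrightarrow> i \<in> A"
      "\<And>i j. {i, j} \<in> E \<longleftrightarrow> {\<pi> i, \<pi> j} \<in> complete_bipartite n a"
    using assms by (rule graph_iso_preimage) blast
  have "adj_matrix E i j = cut_matrix A i j" if "i \<in> {1..n}" "j \<in> {1..n}" for i j
    using complete_bipartite_iff[OF \<pi>(1)[OF that(1)] \<pi>(1)[OF that(2)], of a]
    unfolding \<pi>(3)[symmetric] \<pi>(2)[OF that(1)] \<pi>(2)[OF that(2)]
    by (simp add: adj_matrix_def cut_matrix_def)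
  then show ?thesis
    using A by (intro exI[of _ A]) simp
qed

lemma adj_matrix_of_iso_two_cliques:
  assumes "graph_iso n E (two_cliques n a)" "a \<le> n"
  shows "\<exists>A\<subseteq>{1..n}. card A = a \<and> (\<forall>i\<in>{1..n}. \<forall>j\<in>{1..n}. adj_matrix E i j = clique_pair_matrix A i j)"
proof -
  obtain \<pi> A where A: "A \<subseteq> {1..n}" "card A = a"
    and \<pi>: "\<And>i. i \<in> {1..n} \<Longrightarrow> \<pi> i \<in> {1..n}" "\<And>i. i \<in> {1..n} \<Longrightarrow> \<pi> i \<in> {1..a} \<longleftrightarrow> i \<in> A"
      "\<And>i j. \<pi> i = \<pi> j \<longleftrightarrow> i = j" "\<And>i j. {i, j} \<in> E \<longleftrightarrow> {\<pi> i, \<pi> j} \<in> two_cliques n a"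
    using assms by (rule graph_iso_preimage) blast
  have "adj_matrix E i j = clique_pair_matrix A i j" if "i \<in> {1..n}" "j \<in> {1..n}" for i j
    using two_cliques_iff[OF \<pi>(1)[OF that(1)] \<pi>(1)[OF that(2)], of a]
    unfolding \<pi>(4)[symmetric] \<pi>(2)[OF that(1)] \<pi>(2)[OF that(2)] \<pi>(3)
    by (simp add: adj_matrix_def clique_pair_matrix_def)
  then show ?thesis
    using A by (intro exI[of _ A]) simp
qed

lemma exists_permutation_onto_initial:
  assumes "A \<subseteq> {1..n}"
  obtains \<pi> where "\<pi> permutes {1..n}" "\<And>i. i \<in> {1..n} \<Longrightarrow> \<pi> i \<in> {1..card A} \<longleftrightarrow> i \<in> A"
proof -
  have fin: "finite A" using assms by (rule finite_subset) simp
  obtain f where f: "bij_betw f A {1..card A}"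
    using finite_same_card_bij[OF fin, of "{1..card A}"] by auto
  have "card A \<le> n" using card_mono[OF _ assms] by simp
  then have "{1..card A} \<subseteq> {1..n}" by auto
  then obtain \<pi> where \<pi>: "\<pi> permutes {1..n}" "\<And>x. x \<in> A \<Longrightarrow> \<pi> x = f x"
    using exists_permutation_extending[OF _ assms _ f] by blast
  have img: "\<pi> ` A = {1..card A}"
    using f \<pi>(2) by (auto simp: bij_betw_def)
  have "\<pi> i \<in> {1..card A} \<longleftrightarrow> i \<in> A" for i
    unfolding img[symmetric] using permutes_inj[OF \<pi>(1)] by (rule inj_image_mem_iff)
  with \<pi>(1) show ?thesis by (intro that)
qed

lemma graph_iso_complete_bipartite:
  assumes E: "simple_graph n E" and A: "A \<subseteq> {1..n}"
    and adj: "\<And>i j. i \<in> {1..n} \<Longrightarrow> j \<in> {1..n} \<Longrightarrow> adj_matrix E i j = cut_matrix A i j"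
  shows "graph_iso n E (complete_bipartite n (card A))"
proof -
  obtain \<pi> where \<pi>: "\<pi> permutes {1..n}" "\<And>i. i \<in> {1..n} \<Longrightarrow> \<pi> i \<in> {1..card A} \<longleftrightarrow> i \<in> A"
    using exists_permutation_onto_initial[OF A] by blast
  have le: "card A \<le> n" using card_mono[OF _ A] by simp
  show ?thesis
  proof (rule graph_isoI[OF E simple_graph_complete_bipartite[OF le] \<pi>(1)])
    fix i j assume ij: "i \<in> {1..n}" "j \<in> {1..n}"
    then have "\<pi> i \<in> {1..n}" "\<pi> j \<in> {1..n}"
      using permutes_in_image[OF \<pi>(1)] by blast+
    then show "{i, j} \<in> E \<longleftrightarrow> {\<pi> i, \<pi> j} \<in> complete_bipartite n (card A)"
      using adj[OF ij] unfolding complete_bipartite_iff[OF \<open>\<pi> i \<in> {1..n}\<close> \<open>\<pi> j \<in> {1..n}\<close>]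
        \<pi>(2)[OF ij(1)] \<pi>(2)[OF ij(2)]
      by (simp add: adj_matrix_def cut_matrix_def split: if_splits)
  qed
qed

lemma graph_iso_two_cliques:
  assumes E: "simple_graph n E" and A: "A \<subseteq> {1..n}"
    and adj: "\<And>i j. i \<in> {1..n} \<Longrightarrow> j \<in> {1..n} \<Longrightarrow> adj_matrix E i j = clique_pair_matrix A i j"
  shows "graph_iso n E (two_cliques n (card A))"
proof -
  obtain \<pi> where \<pi>: "\<pi> permutes {1..n}" "\<And>i. i \<in> {1..n} \<Longrightarrow> \<pi> i \<in> {1..card A} \<longleftrightarrow> i \<in> A"
    using exists_permutation_onto_initial[OF A] by blast
  have le: "card A \<le> n" using card_mono[OF _ A] by simp
  show ?thesis
  proof (rule graph_isoI[OF E simple_graph_two_cliques[OF le] \<pi>(1)])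
    fix i j assume ij: "i \<in> {1..n}" "j \<in> {1..n}"
    then have "\<pi> i \<in> {1..n}" "\<pi> j \<in> {1..n}"
      using permutes_in_image[OF \<pi>(1)] by blast+
    moreover have "\<pi> i = \<pi> j \<longleftrightarrow> i = j"
      using permutes_inj[OF \<pi>(1)] by (simp add: inj_eq)
    ultimately show "{i, j} \<in> E \<longleftrightarrow> {\<pi> i, \<pi> j} \<in> two_cliques n (card A)"
      using adj[OF ij] \<pi>(2)[OF ij(1)] \<pi>(2)[OF ij(2)]
      by (simp only: two_cliques_iff) (simp add: adj_matrix_def clique_pair_matrix_def split: if_splits)
  qed
qed

section \<open>Combination of the cases\<close>

lemma row_sum_base_cong:
  assumes "\<And>i j. i \<in> V \<Longrightarrow> j \<in> V \<Longrightarrow> G i j = G' i j" "i \<in> V"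
  shows "row_sum V G i = row_sum V G' i"
  unfolding row_sum_def using assms by (intro sum.cong) auto

lemma balanced_base_cong:
  assumes "\<And>i j. i \<in> V \<Longrightarrow> j \<in> V \<Longrightarrow> G i j = G' i j"
  shows "balanced V G lam T \<longleftrightarrow> balanced V G' lam T"
proof -
  have row: "row_sum V G i = row_sum V G' i" if "i \<in> V" for i
    using assms that by (rule row_sum_base_cong)
  have "{row_sum V G i - row_sum V G j | i j. i \<in> V \<and> j \<in> V}
      = {row_sum V G' i - row_sum V G' j | i j. i \<in> V \<and> j \<in> V}"
    by (metis (no_types, lifting) row)
  then show ?thesis
    using row by (simp add: balanced_def row_sum_gcd_def)
qed

text \<open>Covers the degenerate forms of a complete graph: K_2 as a cut with a = 1, and K_n as a
  pair of cliques one of which is empty.\<close>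

lemma off_diagonal_in_span_of_complete:
  assumes "finite V" "\<And>i j. i \<in> V \<Longrightarrow> j \<in> V \<Longrightarrow> G i j = off_diagonal 1 i j"
  shows "off_diagonal lam \<in> copy_span V G"
  using copy_span_scale[OF copy_span_base[OF assms(1), of G], of lam]
  by (rule copy_span_cong) (simp add: assms(2) off_diagonal_def)

text \<open>If all 4-cycle coefficients are even, the graph is a cut or a pair of cliques of
  non-exceptional size. This leaves n = 2a with a even, where the Hadamard construction applies, and
  complete graphs.\<close>

lemma generic_span_iff:
  assumes E: "simple_graph n E" "card E > 0"
    and generic: "\<nexists>a. exceptional_size n a \<and>
      (graph_iso n E (complete_bipartite n a) \<or> graph_iso n E (two_cliques n a))"
  shows "off_diagonal lam \<in> copy_span {1..n} (adj_matrix E) \<longleftrightarrow> ell n E dvd lam"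
proof
  assume "off_diagonal lam \<in> copy_span {1..n} (adj_matrix E)"
  then obtain c where "\<And>i j. i \<in> {1..n} \<Longrightarrow> j \<in> {1..n} \<Longrightarrow>
      signed_sum {1..n} c (adj_matrix E) i j = off_diagonal lam i j"
    unfolding copy_span_def by blast
  from balanced_of_signed_sum[OF finite_atLeastAtMost this]
  show "ell n E dvd lam"
    using exists_balanced_iff[OF E] by blast
next
  let ?V = "{1..n}" and ?G = "adj_matrix E"
  assume "ell n E dvd lam"
  then obtain T where bal: "balanced ?V ?G lam T"
    using exists_balanced_iff[OF E] by blast
  have hollow: "hollow_symmetric ?G"
    using E(1) by (rule adj_matrix_hollow_symmetric)
  have vals: "?G i j = 0 \<or> ?G i j = 1" for i j
    by (simp add: adj_matrix_def)
  have total: "(\<Sum>i\<in>?V. row_sum ?V ?G i) > 0"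
    using sum_row_sum_adj_matrix[OF E(1)] E(2) by simp
  show "off_diagonal lam \<in> copy_span ?V ?G"
  proof (cases "\<exists>i j k l. distinct [i, j, k, l] \<and> {i, j, k, l} \<subseteq> ?V \<and> odd (?G i k - ?G j k - ?G i l + ?G j l)")
    case True
    then obtain i j k l where ijkl: "distinct [i, j, k, l]" "{i, j, k, l} \<subseteq> ?V"
      "odd (?G i k - ?G j k - ?G i l + ?G j l)"
      by blast
    \<comment> \<open>With entries 0 and 1 the coefficient lies between -2 and 2, so odd means 1 or
      -1.\<close>
    have "\<bar>?G i k - ?G j k - ?G i l + ?G j l\<bar> = 1"
      using vals[of i k] vals[of j k] vals[of i l] vals[of j l] ijkl(3) by auto
    then show ?thesis
      using ijkl bal hollow by (intro off_diagonal_in_span) auto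
  next
    case False
    have "1 \<in> ?V"
      using total by (cases n) auto
    then obtain A where A: "A \<subseteq> ?V" and
      "(\<forall>i\<in>?V. \<forall>j\<in>?V. ?G i j = cut_matrix A i j) \<or> (\<forall>i\<in>?V. \<forall>j\<in>?V. ?G i j = clique_pair_matrix A i j)"
      using cut_or_clique_pair[OF hollow vals, of 1 ?V] False by blast
    then consider (cut) "\<And>i j. i \<in> ?V \<Longrightarrow> j \<in> ?V \<Longrightarrow> ?G i j = cut_matrix A i j"
      | (cliques) "\<And>i j. i \<in> ?V \<Longrightarrow> j \<in> ?V \<Longrightarrow> ?G i j = clique_pair_matrix A i j"
      by blast
    then show ?thesis
    proof cases
      case cut
      have span_eq: "copy_span ?V ?G = copy_span ?V (cut_matrix A)"
        using cut by (rule copy_span_base_cong)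
      have bal_eq: "balanced ?V ?G x T = balanced ?V (cut_matrix A) x T" for x T
        using cut by (rule balanced_base_cong)
      have row: "row_sum ?V ?G i = row_sum ?V (cut_matrix A) i" if "i \<in> ?V" for i
        using cut that by (rule row_sum_base_cong)
      have "(\<Sum>i\<in>?V. row_sum ?V ?G i) = (\<Sum>i\<in>?V. row_sum ?V (cut_matrix A) i)"
        by (intro sum.cong refl row)
      then have "int (card A) * (int n - int (card A)) > 0"
        using total sum_row_sum_cut_matrix[OF _ A] by simp
      then have a: "card A \<ge> 1" "card A < n"
        by (auto simp: zero_less_mult_iff)
      have "\<not> exceptional_size n (card A)"
        using generic graph_iso_complete_bipartite[OF E(1) A cut] by blast
      then have n: "n = 2 * card A" and "even (card A) \<or> card A = 1"
        using a by (auto simp: exceptional_size_def)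
      from this(2) show ?thesis
      proof
        assume "even (card A)"
        then show ?thesis
          using A n a bal balanced_cut_in_span[of ?V A lam T] bal_eq span_eq by simp
      next
        assume "card A = 1"
        then obtain x where x: "A = {x}" by (metis card_1_singletonE)
        have V: "?V = {1, 2}" using n \<open>card A = 1\<close> by auto
        have "?G i j = off_diagonal 1 i j" if "i \<in> ?V" "j \<in> ?V" for i j
          using cut[OF that] that A unfolding x V by (auto simp: cut_matrix_def off_diagonal_def)
        then show ?thesis
          by (intro off_diagonal_in_span_of_complete) auto
      qed
    next
      case cliques
      have span_eq: "copy_span ?V ?G = copy_span ?V (clique_pair_matrix A)"
        using cliques by (rule copy_span_base_cong)
      have bal_eq: "balanced ?V ?G x T = balanced ?V (clique_pair_matrix A) x T" for x T
        using cliques by (rule balanced_base_cong)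
      have row: "row_sum ?V ?G i = row_sum ?V (clique_pair_matrix A) i" if "i \<in> ?V" for i
        using cliques that by (rule row_sum_base_cong)
      have "(\<Sum>i\<in>?V. row_sum ?V ?G i) = (\<Sum>i\<in>?V. row_sum ?V (clique_pair_matrix A) i)"
        by (intro sum.cong refl row)
      then have pos: "int n * (int n - 1) - 2 * (int (card A) * (int n - int (card A))) > 0"
        using total sum_row_sum_clique_pair_matrix[OF _ A] by simp
      show ?thesis
      proof (cases "A = {} \<or> A = ?V")
        case True
        then have "?G i j = off_diagonal 1 i j" if "i \<in> ?V" "j \<in> ?V" for i j
          using cliques[OF that] that by (auto simp: clique_pair_matrix_def off_diagonal_def)
        then show ?thesis
          by (intro off_diagonal_in_span_of_complete) auto
      next
        case False
        have "finite A" using A by (rule finite_subset) simp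
        then have a: "card A \<ge> 1" "card A < n"
          using False A psubset_card_mono[of ?V A] by (auto simp: Suc_le_eq card_gt_0_iff)
        have "\<not> exceptional_size n (card A)"
          using generic graph_iso_two_cliques[OF E(1) A cliques] by blast
        then have n: "n = 2 * card A" and "even (card A) \<or> card A = 1"
          using a by (auto simp: exceptional_size_def)
        \<comment> \<open>For n = 2 and a = 1 the two cliques are single vertices, contradicting the
          presence of an edge.\<close>
        moreover have "card A \<noteq> 1"
          using pos n by auto
        ultimately have "even (card A)" by simp
        then show ?thesis
          using A n a bal balanced_clique_pair_in_span[of ?V A lam T] bal_eq span_eq by simp
      qed
    qed
  qed
qed

text \<open>Two descriptions of one set of multiplicities: \<open>ell_exceptional\<close> comes from
  admissible design parameters, the lcm from adding the evenness of lam to the degree condition.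
  Comparing them spares a direct computation with the gcds.\<close>

lemma complete_bipartite_span_iff:
  assumes E: "simple_graph n E" "card E > 0"
    and exc: "exceptional_size n a" and iso: "graph_iso n E (complete_bipartite n a)"
  shows "off_diagonal lam \<in> copy_span {1..n} (adj_matrix E) \<longleftrightarrow> ell_exceptional n E a dvd lam"
    and "off_diagonal lam \<in> copy_span {1..n} (adj_matrix E) \<longleftrightarrow> lcm 2 (ell n E) dvd lam"
proof -
  let ?V = "{1..n}" and ?G = "adj_matrix E"
  let ?design = "\<exists>T t u. design_admissible (int n) (int a) T t u \<and> lam = 2 * (t - u)"
  have a: "1 \<le> a" "a < n" using exc by (auto simp: exceptional_size_def)
  obtain A where A: "A \<subseteq> ?V" "card A = a"
    and cut: "\<And>i j. i \<in> ?V \<Longrightarrow> j \<in> ?V \<Longrightarrow> ?G i j = cut_matrix A i j"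
    using adj_matrix_of_iso_complete_bipartite[OF iso less_imp_le[OF a(2)]] by blast
  have excA: "exceptional_size (card ?V) (card A)" using exc A(2) by simp
  have span_eq: "copy_span ?V ?G = copy_span ?V (cut_matrix A)"
    using cut by (rule copy_span_base_cong)
  have bal_eq: "balanced ?V ?G lam T = balanced ?V (cut_matrix A) lam T" for T
    using cut by (rule balanced_base_cong)
  have span: "off_diagonal lam \<in> copy_span ?V ?G \<longleftrightarrow> ?design"
    using cut_exceptional_iff[OF _ A(1) excA, of lam] A(2) unfolding span_eq by simp
  have row: "row_sum ?V ?G i = row_sum ?V (cut_matrix A) i" if "i \<in> ?V" for i
    using cut that by (rule row_sum_base_cong)
  have "(\<Sum>i\<in>?V. row_sum ?V ?G i) = (\<Sum>i\<in>?V. row_sum ?V (cut_matrix A) i)"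
    by (intro sum.cong refl row)
  then have e: "2 * int (card E) = 0 * (int n * (int n - 1)) + 2 * (int a * (int n - int a))"
    using sum_row_sum_adj_matrix[OF E(1)] sum_row_sum_cut_matrix[OF _ A(1)] A(2) by simp
  show "off_diagonal lam \<in> copy_span ?V ?G \<longleftrightarrow> ell_exceptional n E a dvd lam"
    unfolding span using ell_exceptional_dvd_iff[OF E(2) _ e, of lam] a by simp
  show "off_diagonal lam \<in> copy_span ?V ?G \<longleftrightarrow> lcm 2 (ell n E) dvd lam"
  proof
    assume "off_diagonal lam \<in> copy_span ?V ?G"
    then obtain c where c: "\<And>i j. i \<in> ?V \<Longrightarrow> j \<in> ?V \<Longrightarrow> signed_sum ?V c ?G i j = off_diagonal lam i j"
      unfolding copy_span_def by blast
    have "ell n E dvd lam"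
      using balanced_of_signed_sum[OF finite_atLeastAtMost c] exists_balanced_iff[OF E] by blast
    moreover have "even lam"
      using \<open>off_diagonal lam \<in> copy_span ?V ?G\<close> unfolding span by auto
    ultimately show "lcm 2 (ell n E) dvd lam"
      by (rule lcm_least[rotated])
  next
    assume "lcm 2 (ell n E) dvd lam"
    then have "even lam" "ell n E dvd lam"
      by (auto dest: lcm_dvdD1 lcm_dvdD2)
    then obtain T where "balanced ?V (cut_matrix A) lam T"
      using exists_balanced_iff[OF E] bal_eq by blast
    from design_admissible_of_even_balanced[OF _ A(1) excA this \<open>even lam\<close>]
    show "off_diagonal lam \<in> copy_span ?V ?G"
      unfolding span using A(2) by auto
  qed
qed

lemma two_cliques_span_iff:
  assumes E: "simple_graph n E" "card E > 0"
    and exc: "exceptional_size n a" and iso: "graph_iso n E (two_cliques n a)"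
  shows "off_diagonal lam \<in> copy_span {1..n} (adj_matrix E) \<longleftrightarrow> ell_exceptional n E a dvd lam"
proof -
  let ?V = "{1..n}" and ?G = "adj_matrix E"
  have a: "1 \<le> a" "a < n" using exc by (auto simp: exceptional_size_def)
  obtain A where A: "A \<subseteq> ?V" "card A = a"
    and cliques: "\<And>i j. i \<in> ?V \<Longrightarrow> j \<in> ?V \<Longrightarrow> ?G i j = clique_pair_matrix A i j"
    using adj_matrix_of_iso_two_cliques[OF iso less_imp_le[OF a(2)]] by blast
  have excA: "exceptional_size (card ?V) (card A)" using exc A(2) by simp
  have span_eq: "copy_span ?V ?G = copy_span ?V (clique_pair_matrix A)"
    using cliques by (rule copy_span_base_cong)
  have row: "row_sum ?V ?G i = row_sum ?V (clique_pair_matrix A) i" if "i \<in> ?V" for i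
    using cliques that by (rule row_sum_base_cong)
  have "(\<Sum>i\<in>?V. row_sum ?V ?G i) = (\<Sum>i\<in>?V. row_sum ?V (clique_pair_matrix A) i)"
    by (intro sum.cong refl row)
  then have e: "2 * int (card E) = 1 * (int n * (int n - 1)) + (-2) * (int a * (int n - int a))"
    using sum_row_sum_adj_matrix[OF E(1)] sum_row_sum_clique_pair_matrix[OF _ A(1)] A(2) by simp
  have "T - 2 * (t - u) = 1 * T + (-2) * (t - u)" for T t u :: int
    by simp
  then have "off_diagonal lam \<in> copy_span ?V ?G \<longleftrightarrow>
      (\<exists>T t u. design_admissible (int n) (int a) T t u \<and> lam = 1 * T + (-2) * (t - u))"
    using clique_pair_exceptional_iff[OF finite_atLeastAtMost A(1) excA, of lam] A(2)
    unfolding span_eq by (simp only: card_atLeastAtMost diff_Suc_1)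
  then show ?thesis
    using ell_exceptional_dvd_iff[OF E(2) _ e, of lam] a by simp
qed

theorem theorem1p1:
  fixes n :: nat and E :: "nat set set" and lam :: int
  assumes "simple_graph n E"
    and "card E > 0"
  shows
    "((\<nexists>a. exceptional_size n a \<and>
          (graph_iso n E (complete_bipartite n a) \<or> graph_iso n E (two_cliques n a))) \<longrightarrow>
        ((\<exists>c. signed_decomposition n E lam c) \<longleftrightarrow> ell n E dvd lam))
     \<and>
     (\<forall>a. exceptional_size n a \<and> graph_iso n E (complete_bipartite n a) \<longrightarrow>
        ((\<exists>c. signed_decomposition n E lam c) \<longleftrightarrow> lcm 2 (ell n E) dvd lam) \<and>
        lcm 2 (ell n E) = ell_exceptional n E a)
     \<and>
     (\<forall>a. exceptional_size n a \<and> graph_iso n E (two_cliques n a) \<longrightarrow>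
        ((\<exists>c. signed_decomposition n E lam c) \<longleftrightarrow> ell_exceptional n E a dvd lam))"
  unfolding signed_decomposition_iff
proof (intro conjI allI impI; (elim conjE)?)
  fix a assume "exceptional_size n a" "graph_iso n E (complete_bipartite n a)"
  note iff = complete_bipartite_span_iff[OF assms this]
  show "off_diagonal lam \<in> copy_span {1..n} (adj_matrix E) \<longleftrightarrow> lcm 2 (ell n E) dvd lam"
    by (rule iff(2))
  \<comment> \<open>\<open>lam\<close> is schematic in \<open>iff\<close>, so both values have the
    same multiples; being nonnegative, they are equal.\<close>
  have dvd_iff: "ell_exceptional n E a dvd x \<longleftrightarrow> lcm 2 (ell n E) dvd x" for x
    using iff[of x] by blast
  have "lcm 2 (ell n E) dvd ell_exceptional n E a" "ell_exceptional n E a dvd lcm 2 (ell n E)"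
    by (rule dvd_iff[THEN iffD1, OF dvd_refl], rule dvd_iff[THEN iffD2, OF dvd_refl])
  then show "lcm 2 (ell n E) = ell_exceptional n E a"
    by (intro zdvd_antisym_nonneg lcm_ge_0_int ell_exceptional_nonneg)
qed (use generic_span_iff[OF assms] two_cliques_span_iff[OF assms] in auto)

end
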